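(* Let $\mathbb{T}$ be a time scale. Suppose that (1) $a,b\in\mathbb{T}$ and $I_k: a=x_0<x_1<\cdots<x_{k-1}<x_k=b$ is a division of the interval $[a,b]$ for $x_0,x_1,\dots,x_k\in\mathbb{T}$; (2) $\alpha_i\in\mathbb{T}$ $(i=0,\dots,k+1)$ are $k+2$ points such that $\alpha_0=a$, $\alpha_i\in[x_{i-1},x_i]$ $(i=1,\dots,k)$ and $\alpha_{k+1}=b$; (3) $f:[a,b]\to\mathbb{R}$ is differentiable. Then $$\left|\int_a^b f^\sigma(t)\,\Delta t-\sum_{i=0}^k(\alpha_{i+1}-\alpha_i)f(x_i)\right|\le M\sum_{i=0}^{k-1}\Big(h_2(x_i,\alpha_{i+1})+h_2(x_{i+1},\alpha_{i+1})\Big),$$ where $M=\sup_{a<x<b}|f^\Delta(x)|$. This inequality is sharp in the sense that its right-hand side cannot be replaced by a smaller one.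
   Context: A time scale $\mathbb{T}$ is an arbitrary nonempty closed subset of $\mathbb{R}$. An interval means the intersection of the real interval with $\mathbb{T}$. The forward jump operator is $\sigma(t)=\inf\{s\in\mathbb{T}:s>t\}$ (with $\sigma(t)=t$ if $t=\max\mathbb{T}$), and $f^\sigma(t)=f(\sigma(t))$. If $\mathbb{T}$ has a left-scattered maximum $m$ (i.e. $\sup\{s\in\mathbb{T}:s<m\}<m$), then $\mathbb{T}^\kappa=\mathbb{T}\setminus\{m\}$; otherwise $\mathbb{T}^\kappa=\mathbb{T}$. For $t\in\mathbb{T}^\kappa$, $f^\Delta(t)$ is the number, if it exists, such that for every $\varepsilon>0$ there is a neighborhood $U$ of $t$ in $\mathbb{T}$ with $|f(\sigma(t))-f(s)-f^\Delta(t)(\sigma(t)-s)|\le\varepsilon|\sigma(t)-s|$ for all $s\in U$. Differentiable means $\Delta$-differentiable, i.e. $f^\Delta(t)$ exists for all $t\in\mathbb{T}^\kappa$; for a function on $[a,b]$ this is read with the time scale $[a,b]\cap\mathbb{T}$ in place of $\mathbb{T}$. $F$ is a $\Delta$-antiderivative of $g$ if $F^\Delta=g$ on $\mathbb{T}^\kappa$ (with the same reading for functions on $[a,b]$), and then $\int_c^d g(t)\,\Delta t=F(d)-F(c)$. Define $h_0(t,s)=1$ and $h_{k+1}(t,s)=\int_s^t h_k(\tau,s)\,\Delta\tau$ for $s,t\in\mathbb{T}$; thus $h_2(t,s)=\int_s^t(\tau-s)\,\Delta\tau$.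
   Formalization: In M the point a is added to the range a<x<b exactly when a is right-scattered and α_1≠a; with the printed M the inequality fails there, e.g. T={0,1,2}, k=1, x_0=0, α_1=1, x_1=2, f(0)=1, f(1)=f(2)=0: left side 1, right side 0. *)

theory Defs
  imports "HOL-Analysis.Analysis"
begin

definition time_scale :: "real set \<Rightarrow> bool" where
  "time_scale T \<longleftrightarrow> closed T \<and> T \<noteq> {}"

definition fwd_jump :: "real set \<Rightarrow> real \<Rightarrow> real" where
  "fwd_jump T t = (if \<exists>s\<in>T. t < s then Inf {s \<in> T. t < s} else t)"

(* The supremum of the empty set is an arbitrary real number here, so the one-point time
   scale is treated separately: its only point is not left-scattered. *)
definition left_scattered_max :: "real set \<Rightarrow> real \<Rightarrow> bool" where
  "left_scattered_max T m \<longleftrightarrow>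
     m \<in> T \<and> (\<forall>s\<in>T. s \<le> m) \<and> (\<exists>s\<in>T. s < m) \<and> Sup {s \<in> T. s < m} < m"

definition ts_kappa :: "real set \<Rightarrow> real set" where
  "ts_kappa T = {t \<in> T. \<not> left_scattered_max T t}"

definition has_delta_deriv ::
    "real set \<Rightarrow> (real \<Rightarrow> real) \<Rightarrow> real \<Rightarrow> real \<Rightarrow> bool" where
  "has_delta_deriv T f D t \<longleftrightarrow>
     (\<forall>\<epsilon>>0. \<exists>U. open U \<and> t \<in> U \<and>
        (\<forall>s\<in>U \<inter> T. \<bar>f (fwd_jump T t) - f s - D * (fwd_jump T t - s)\<bar>
                      \<le> \<epsilon> * \<bar>fwd_jump T t - s\<bar>))"

definition delta_differentiable :: "real set \<Rightarrow> (real \<Rightarrow> real) \<Rightarrow> bool" where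
  "delta_differentiable T f \<longleftrightarrow> (\<forall>t\<in>ts_kappa T. \<exists>D. has_delta_deriv T f D t)"

(* The derivative is unique at the points of ts_kappa T, provided T has at least two points. *)
definition delta_deriv :: "real set \<Rightarrow> (real \<Rightarrow> real) \<Rightarrow> real \<Rightarrow> real" where
  "delta_deriv T f t = (THE D. has_delta_deriv T f D t)"

definition delta_antideriv ::
    "real set \<Rightarrow> (real \<Rightarrow> real) \<Rightarrow> (real \<Rightarrow> real) \<Rightarrow> bool" where
  "delta_antideriv T F g \<longleftrightarrow> (\<forall>t\<in>ts_kappa T. has_delta_deriv T F (g t) t)"

(* For c, d in T the value does not depend on the antiderivative F; it is unspecified if g has
   no antiderivative on T. Functions that live on [a,b] are integrated with T replaced by
   {a..b} \<inter> T. *)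
definition delta_integral ::
    "real set \<Rightarrow> (real \<Rightarrow> real) \<Rightarrow> real \<Rightarrow> real \<Rightarrow> real" where
  "delta_integral T g c d = (THE I. \<exists>F. delta_antideriv T F g \<and> I = F d - F c)"

primrec ts_h :: "real set \<Rightarrow> nat \<Rightarrow> real \<Rightarrow> real \<Rightarrow> real" where
  "ts_h T 0 = (\<lambda>t s. 1)"
| "ts_h T (Suc k) = (\<lambda>t s. delta_integral T (\<lambda>\<tau>. ts_h T k \<tau> s) s t)"

(* Here f is a function on [a,b], so the forward jump, too, is that of {a..b} \<inter> T. *)
definition ostrowski_error ::
    "real set \<Rightarrow> real \<Rightarrow> real \<Rightarrow> nat \<Rightarrow> (nat \<Rightarrow> real) \<Rightarrow> (nat \<Rightarrow> real) \<Rightarrow> (real \<Rightarrow> real) \<Rightarrow> real" where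
  "ostrowski_error T a b k x \<alpha> f =
     \<bar>delta_integral ({a..b} \<inter> T) (\<lambda>t. f (fwd_jump ({a..b} \<inter> T) t)) a b
      - (\<Sum>i=0..k. (\<alpha> (i + 1) - \<alpha> i) * f (x i))\<bar>"

definition ostrowski_weight ::
    "real set \<Rightarrow> nat \<Rightarrow> (nat \<Rightarrow> real) \<Rightarrow> (nat \<Rightarrow> real) \<Rightarrow> real" where
  "ostrowski_weight T k x \<alpha> =
     (\<Sum>i<k. ts_h T 2 (x i) (\<alpha> (i + 1)) + ts_h T 2 (x (i + 1)) (\<alpha> (i + 1)))"

(* The supremum is taken over the open interval (a,b) of T, to which the point a is added
   exactly when a is right-scattered and \<alpha> 1 \<noteq> a. In that case the open interval does not
   suffice: in T = {0,1,2} with k = 1, x 0 = 0, \<alpha> 1 = 1, x 1 = 2, the function with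
   f 0 = 1, f 1 = f 2 = 0 has derivative 0 on (0,2), but error 1.
   The supremum is an extended real because the derivative may be unbounded. *)
definition ostrowski_sup ::
    "real set \<Rightarrow> real \<Rightarrow> real \<Rightarrow> (nat \<Rightarrow> real) \<Rightarrow> (real \<Rightarrow> real) \<Rightarrow> ereal" where
  "ostrowski_sup T a b \<alpha> f =
     (SUP t\<in>(if a < fwd_jump T a \<and> \<alpha> 1 \<noteq> a then {a..<b} else {a<..<b}) \<inter> T.
        ereal \<bar>delta_deriv ({a..b} \<inter> T) f t\<bar>)"

end

theory Submission
  imports Defs
begin

text \<open>Let \<open>F\<close> be an antiderivative of \<open>f\<^sup>\<sigma>\<close>. On \<open>[x\<^sub>i, x\<^sub>i\<^sub>+\<^sub>1]\<close> the function
  \<open>P\<^sub>i(t) = (t - \<alpha>\<^sub>i\<^sub>+\<^sub>1) f(t) - F(t)\<close> has the delta derivative \<open>(t - \<alpha>\<^sub>i\<^sub>+\<^sub>1) f\<^sup>\<Delta>(t)\<close>, and summation by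
  parts turns the error into the sum of the increments of the \<open>P\<^sub>i\<close>. By the mean value theorem these are
  at most \<open>M\<close> times the increments of an antiderivative of \<open>|t - \<alpha>\<^sub>i\<^sub>+\<^sub>1|\<close>, which are the summands of
  the weight. For sharpness take \<open>f\<^sup>\<Delta>\<close> to be a continuous approximation of the sign of
  \<open>t - \<alpha>\<^sub>i\<^sub>+\<^sub>1\<close>, rescaled so that the supremum is the given one; if the given supremum is infinite,
  add a multiple of such a function to \<open>f\<close>.\<close>

section \<open>Delta derivatives\<close>

text \<open>The integral is defined through antiderivatives, so every integrand first needs one. All
  of them come from one construction: \<sigma> is taken on the whole real line and
  \<open>\<phi> (\<sigma> u)\<close> is integrated in the ordinary sense. Since \<sigma> is constant
  on a gap [t, \<sigma>(t)), the gap contributes \<phi>(\<sigma>(t)) times its length, exactly what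
  the delta derivative demands at a right-scattered point. This is why the approximate sign is
  evaluated at \<sigma>(t) and not at t.

  A second obstacle is the left end point. The supremum sees a only if a is right-scattered and
  \<alpha> 1 differs from a. So the mean value theorem must do without the derivative at a
  right-dense left end, and for \<alpha> 1 = a the factor t - \<alpha> 1 vanishes at a.

  Finally, the supremum may be infinite, or run over an empty set, and then multiplies a weight that
  may be zero; these cases need arguments of their own.\<close>

lemma has_delta_deriv_iff:
  "has_delta_deriv T f D t \<longleftrightarrow>
     (\<forall>\<epsilon>>0. \<forall>\<^sub>F s in nhds t. s \<in> T \<longrightarrow>
        \<bar>f (fwd_jump T t) - f s - D * (fwd_jump T t - s)\<bar> \<le> \<epsilon> * \<bar>fwd_jump T t - s\<bar>)"
  unfolding has_delta_deriv_def eventually_nhds by (intro all_cong imp_cong ex_cong) auto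

lemma has_delta_derivD:
  assumes "has_delta_deriv T f D t" "\<epsilon> > 0"
  shows "\<forall>\<^sub>F s in nhds t. s \<in> T \<longrightarrow>
     \<bar>f (fwd_jump T t) - f s - D * (fwd_jump T t - s)\<bar> \<le> \<epsilon> * \<bar>fwd_jump T t - s\<bar>"
  using assms has_delta_deriv_iff by blast

section \<open>The forward jump operator\<close>

lemma fwd_jump_ge: "t \<le> fwd_jump T t"
proof (cases "\<exists>s\<in>T. t < s")
  case True
  then have "t \<le> Inf {s \<in> T. t < s}" by (intro cInf_greatest) auto
  with True show ?thesis by (simp add: fwd_jump_def)
qed (simp add: fwd_jump_def)

lemma fwd_jump_le: "s \<in> T \<Longrightarrow> t < s \<Longrightarrow> fwd_jump T t \<le> s"
  by (auto simp: fwd_jump_def intro!: cInf_lower bdd_belowI[of _ t])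

lemma fwd_jump_in: 
  assumes "closed T" "t \<in> T"
  shows "fwd_jump T t \<in> T"
proof (cases "\<exists>s\<in>T. t < s")
  case True
  have "Inf {s \<in> T. t < s} \<in> closure {s \<in> T. t < s}"
    using True by (intro closure_contains_Inf) (auto intro!: bdd_belowI[of _ t])
  also have "\<dots> \<subseteq> T" using assms by (intro closure_minimal) auto
  finally show ?thesis using True by (simp add: fwd_jump_def)
qed (use assms in \<open>simp add: fwd_jump_def\<close>)

text \<open>Monotonicity on all reals, gaps included, is what makes
  \<open>\<phi> \<circ> \<sigma>\<close> Borel measurable for continuous \<phi>.\<close>

lemma mono_fwd_jump: "mono (fwd_jump T)"
proof
  fix u v :: real assume uv: "u \<le> v"
  show "fwd_jump T u \<le> fwd_jump T v"
  proof (cases "\<exists>s\<in>T. v < s")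
    case True
    then have "fwd_jump T u \<le> Inf {s \<in> T. v < s}"
      using uv by (intro cInf_greatest) (auto intro!: fwd_jump_le)
    then show ?thesis using True by (simp add: fwd_jump_def)
  next
    case False
    then have v: "fwd_jump T v = v" by (simp add: fwd_jump_def)
    show ?thesis
    proof (cases "\<exists>s\<in>T. u < s")
      case True
      then obtain s where "s \<in> T" "u < s" by blast
      with False fwd_jump_le[of s T u] v show ?thesis by force
    qed (use v uv in \<open>simp add: fwd_jump_def\<close>)
  qed
qed

text \<open>Makes the integrand \<open>\<phi> (fwd_jump T u)\<close> constant across a gap.\<close>

lemma fwd_jump_const_on_gap:
  assumes "closed T" "t \<in> T" "t \<le> u" "u < fwd_jump T t"
  shows "fwd_jump T u = fwd_jump T t"
proof (rule antisym)
  show "fwd_jump T u \<le> fwd_jump T t"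
    using assms fwd_jump_in by (intro fwd_jump_le)
  show "fwd_jump T t \<le> fwd_jump T u" using assms(3) mono_fwd_jump monoD by blast
qed

text \<open>By convention a maximum of \<open>T\<close> also satisfies
  \<open>fwd_jump T t = t\<close>; the point \<open>d\<close> above \<open>t\<close> excludes it, so
  that \<open>t\<close> is a limit from the right.\<close>

lemma right_dense_point:
  assumes "d \<in> T" "t < d" "fwd_jump T t = t" "t < e"
  obtains s where "s \<in> T" "t < s" "s < e" "s \<le> d"
proof -
  have ex: "\<exists>s\<in>T. t < s" using assms by blast
  then have "Inf {s \<in> T. t < s} < min e d" using assms by (simp add: fwd_jump_def)
  then obtain s where "s \<in> {s \<in> T. t < s}" "s < min e d"
    using ex by (subst (asm) cInf_less_iff) (auto intro!: bdd_belowI[of _ t])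
  with that show ?thesis by auto
qed

lemma ts_kappaI: "t \<in> T \<Longrightarrow> d \<in> T \<Longrightarrow> t < d \<Longrightarrow> t \<in> ts_kappa T"
  by (force simp: ts_kappa_def left_scattered_max_def)

lemma fwd_jump_restrict:
  assumes "t \<in> T" "a \<le> t" "t < b" "b \<in> T"
  shows "fwd_jump ({a..b} \<inter> T) t = fwd_jump T t"
proof (rule antisym)
  have ne: "\<exists>s\<in>T. t < s" "\<exists>s\<in>{a..b} \<inter> T. t < s" using assms by auto
  have "fwd_jump ({a..b} \<inter> T) t \<le> Inf {s \<in> T. t < s}"
  proof (rule cInf_greatest)
    fix s assume s: "s \<in> {s \<in> T. t < s}"
    \<comment> \<open>A competitor \<open>s\<close> beyond \<open>b\<close> is replaced by
      \<open>b\<close>, which belongs to both time scales and still exceeds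
      \<open>t\<close>.\<close>
    have "fwd_jump ({a..b} \<inter> T) t \<le> min s b"
      using s assms by (intro fwd_jump_le) (auto simp: min_def)
    then show "fwd_jump ({a..b} \<inter> T) t \<le> s" by simp
  qed (use ne in auto)
  then show "fwd_jump ({a..b} \<inter> T) t \<le> fwd_jump T t" using ne by (simp add: fwd_jump_def)
  have "fwd_jump T t \<le> Inf {s \<in> {a..b} \<inter> T. t < s}"
    using ne by (intro cInf_greatest) (auto intro: fwd_jump_le)
  then show "fwd_jump T t \<le> fwd_jump ({a..b} \<inter> T) t" using ne(2) unfolding fwd_jump_def by simp
qed

lemma has_delta_deriv_restrict:
  assumes "has_delta_deriv T f D t" "t \<in> T" "a \<le> t" "t < b" "b \<in> T"
  shows "has_delta_deriv ({a..b} \<inter> T) f D t"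
  using assms(1) unfolding has_delta_deriv_iff fwd_jump_restrict[OF assms(2-5)]
  by (auto elim!: eventually_mono)

section \<open>Rules for delta derivatives and their uniqueness\<close>

lemma has_delta_deriv_const: "has_delta_deriv T (\<lambda>_. c) 0 t"
  by (auto simp: has_delta_deriv_iff)

lemma has_delta_deriv_ident: "has_delta_deriv T (\<lambda>s. s) 1 t"
  by (auto simp: has_delta_deriv_iff)

lemma has_delta_deriv_add:
  assumes "has_delta_deriv T f D t" "has_delta_deriv T g E t"
  shows "has_delta_deriv T (\<lambda>s. f s + g s) (D + E) t"
  unfolding has_delta_deriv_iff
proof (intro allI impI)
  fix \<epsilon> :: real assume "\<epsilon> > 0"
  then have e: "\<epsilon> / 2 > 0" by simp
  from has_delta_derivD[OF assms(1) e] has_delta_derivD[OF assms(2) e]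
  show "\<forall>\<^sub>F s in nhds t. s \<in> T \<longrightarrow>
     \<bar>f (fwd_jump T t) + g (fwd_jump T t) - (f s + g s) - (D + E) * (fwd_jump T t - s)\<bar>
       \<le> \<epsilon> * \<bar>fwd_jump T t - s\<bar>"
  proof eventually_elim
    case (elim s)
    have "\<bar>X\<bar> \<le> \<epsilon> / 2 * Z \<Longrightarrow> \<bar>Y\<bar> \<le> \<epsilon> / 2 * Z \<Longrightarrow> \<bar>X + Y\<bar> \<le> \<epsilon> * Z" for X Y Z :: real
      by (simp add: field_simps)
    from this[of "f (fwd_jump T t) - f s - D * (fwd_jump T t - s)" "\<bar>fwd_jump T t - s\<bar>"
        "g (fwd_jump T t) - g s - E * (fwd_jump T t - s)"]
    show ?case using elim by (simp add: algebra_simps)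
  qed
qed

lemma has_delta_deriv_cmult:
  assumes "has_delta_deriv T f D t"
  shows "has_delta_deriv T (\<lambda>s. c * f s) (c * D) t"
  unfolding has_delta_deriv_iff
proof (intro allI impI)
  fix \<epsilon> :: real assume e0: "\<epsilon> > 0"
  then have "\<epsilon> / (\<bar>c\<bar> + 1) > 0" by simp
  from has_delta_derivD[OF assms this]
  show "\<forall>\<^sub>F s in nhds t. s \<in> T \<longrightarrow>
     \<bar>c * f (fwd_jump T t) - c * f s - c * D * (fwd_jump T t - s)\<bar> \<le> \<epsilon> * \<bar>fwd_jump T t - s\<bar>"
  proof eventually_elim
    case (elim s)
    show ?case
    proof
      assume "s \<in> T"
      let ?X = "f (fwd_jump T t) - f s - D * (fwd_jump T t - s)"
      have "\<bar>c * ?X\<bar> \<le> \<bar>c\<bar> * (\<epsilon> / (\<bar>c\<bar> + 1) * \<bar>fwd_jump T t - s\<bar>)"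
        using mult_left_mono[OF mp[OF elim \<open>s \<in> T\<close>] abs_ge_zero[of c]] by (simp only: abs_mult)
      also have "\<dots> = (\<bar>c\<bar> / (\<bar>c\<bar> + 1)) * (\<epsilon> * \<bar>fwd_jump T t - s\<bar>)" by simp
      also have "\<dots> \<le> 1 * (\<epsilon> * \<bar>fwd_jump T t - s\<bar>)"
        using e0 by (intro mult_right_mono) auto
      finally show "\<bar>c * f (fwd_jump T t) - c * f s - c * D * (fwd_jump T t - s)\<bar>
          \<le> \<epsilon> * \<bar>fwd_jump T t - s\<bar>" by (simp add: algebra_simps)
    qed
  qed
qed

lemma has_delta_deriv_diff:
  assumes "has_delta_deriv T f D t" "has_delta_deriv T g E t"
  shows "has_delta_deriv T (\<lambda>s. f s - g s) (D - E) t"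
  using has_delta_deriv_add[OF assms(1) has_delta_deriv_cmult[OF assms(2), of "-1"]] by simp

text \<open>Of the two forms of the product rule, the one that leaves the factor
  \<open>t - c\<close> unshifted. The shifted value of \<open>f\<close> is cancelled later by
  subtracting an antiderivative of it.\<close>

lemma has_delta_deriv_affine_mult:
  assumes "has_delta_deriv T f D t"
  shows "has_delta_deriv T (\<lambda>s. (s - c) * f s) ((t - c) * D + f (fwd_jump T t)) t"
  unfolding has_delta_deriv_iff
proof (intro allI impI)
  fix \<epsilon> :: real assume e0: "\<epsilon> > 0"
  \<comment> \<open>The error splits as \<open>(s - c) * ?X + (s - t) * D * (?\<sigma> - s)\<close>;
    \<open>?\<eta>\<close> and \<open>?\<delta>\<close> give each term half of the
    allowance.\<close>
  let ?\<sigma> = "fwd_jump T t" and ?\<eta> = "\<epsilon> / 2 / (\<bar>t - c\<bar> + 1)" and ?\<delta> = "min 1 (\<epsilon> / 2 / (\<bar>D\<bar> + 1))"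
  have "?\<eta> > 0" using e0 by (intro divide_pos_pos add_nonneg_pos) auto
  have "?\<delta> > 0" using e0 by (simp add: add_nonneg_pos)
  have "\<forall>\<^sub>F s in nhds t. dist s t < ?\<delta>"
    using \<open>?\<delta> > 0\<close> eventually_nhds_metric by blast
  with has_delta_derivD[OF assms \<open>?\<eta> > 0\<close>]
  show "\<forall>\<^sub>F s in nhds t. s \<in> T \<longrightarrow>
     \<bar>(?\<sigma> - c) * f ?\<sigma> - (s - c) * f s - ((t - c) * D + f ?\<sigma>) * (?\<sigma> - s)\<bar> \<le> \<epsilon> * \<bar>?\<sigma> - s\<bar>"
  proof eventually_elim
    case (elim s)
    show ?case
    proof
      assume "s \<in> T"
      let ?X = "f ?\<sigma> - f s - D * (?\<sigma> - s)"
      have 1: "\<bar>?X\<bar> \<le> ?\<eta> * \<bar>?\<sigma> - s\<bar>" using elim \<open>s \<in> T\<close> by blast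
      have 2: "\<bar>s - c\<bar> \<le> \<bar>t - c\<bar> + 1" using elim by (auto simp: dist_real_def)
      have "\<bar>s - t\<bar> \<le> \<epsilon> / 2 / (\<bar>D\<bar> + 1)" using elim by (auto simp: dist_real_def)
      then have "\<bar>s - t\<bar> * (\<bar>D\<bar> + 1) \<le> \<epsilon> / 2"
        by (subst (asm) pos_le_divide_eq) (auto intro: add_nonneg_pos)
      moreover have "\<bar>s - t\<bar> * \<bar>D\<bar> \<le> \<bar>s - t\<bar> * (\<bar>D\<bar> + 1)" by (intro mult_left_mono) auto
      ultimately have 3: "\<bar>s - t\<bar> * \<bar>D\<bar> \<le> \<epsilon> / 2" by linarith
      have "(?\<sigma> - c) * f ?\<sigma> - (s - c) * f s - ((t - c) * D + f ?\<sigma>) * (?\<sigma> - s)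
          = (s - c) * ?X + ((s - t) * D) * (?\<sigma> - s)" by (simp add: algebra_simps)
      also have "\<bar>\<dots>\<bar> \<le> \<bar>s - c\<bar> * \<bar>?X\<bar> + \<bar>s - t\<bar> * \<bar>D\<bar> * \<bar>?\<sigma> - s\<bar>"
        by (metis abs_mult abs_triangle_ineq)
      also have "\<dots> \<le> (\<bar>t - c\<bar> + 1) * (?\<eta> * \<bar>?\<sigma> - s\<bar>) + \<epsilon> / 2 * \<bar>?\<sigma> - s\<bar>"
        using 1 2 3 e0 by (intro add_mono mult_mono) auto
      also have "(\<bar>t - c\<bar> + 1) * (?\<eta> * \<bar>?\<sigma> - s\<bar>) = \<epsilon> / 2 * \<bar>?\<sigma> - s\<bar>"
      proof -
        have "\<bar>t - c\<bar> + 1 \<noteq> 0" using abs_ge_zero[of "t - c"] by linarith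
        then show ?thesis by (metis mult.assoc nonzero_mult_div_cancel_left times_divide_eq_right)
      qed
      also have "\<epsilon> / 2 * \<bar>?\<sigma> - s\<bar> + \<epsilon> / 2 * \<bar>?\<sigma> - s\<bar> = \<epsilon> * \<bar>?\<sigma> - s\<bar>" by simp
      finally show "\<bar>(?\<sigma> - c) * f ?\<sigma> - (s - c) * f s - ((t - c) * D + f ?\<sigma>) * (?\<sigma> - s)\<bar>
          \<le> \<epsilon> * \<bar>?\<sigma> - s\<bar>" .
    qed
  qed
qed

text \<open>The defining inequality says nothing at s = \<sigma>(t), so a different point of
  \<open>T\<close> near \<open>t\<close> is needed: \<open>t\<close> itself if it is
  right-scattered, otherwise a close point to the right.\<close>

lemma has_delta_deriv_unique:
  assumes "has_delta_deriv T f D t" "has_delta_deriv T f E t" "t \<in> T" "d \<in> T" "t < d"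
  shows "D = E"
proof -
  let ?\<sigma> = "fwd_jump T t"
  have diff: "has_delta_deriv T (\<lambda>_. 0) (D - E) t"
    using has_delta_deriv_diff[OF assms(1,2)] by simp
  have "\<bar>D - E\<bar> \<le> 0 + \<epsilon>" if "\<epsilon> > 0" for \<epsilon>
  proof -
    obtain \<delta> where "\<delta> > 0" and
      \<delta>: "\<And>s. dist s t < \<delta> \<Longrightarrow> s \<in> T \<Longrightarrow> \<bar>(D - E) * (?\<sigma> - s)\<bar> \<le> \<epsilon> * \<bar>?\<sigma> - s\<bar>"
      using has_delta_derivD[OF diff \<open>\<epsilon> > 0\<close>] unfolding eventually_nhds_metric by auto
    have "\<exists>s\<in>T. dist s t < \<delta> \<and> s \<noteq> ?\<sigma>"
    proof (cases "?\<sigma> = t")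
      case True
      then obtain s where "s \<in> T" "t < s" "s < t + \<delta>"
        using right_dense_point[of d T t "t + \<delta>"] assms \<open>\<delta> > 0\<close> by auto
      then show ?thesis using True by (intro bexI[of _ s]) (auto simp: dist_real_def)
    qed (use assms \<open>\<delta> > 0\<close> in \<open>auto intro!: bexI[of _ t]\<close>)
    then obtain s where "s \<in> T" "dist s t < \<delta>" "s \<noteq> ?\<sigma>" by blast
    with \<delta> have "\<bar>D - E\<bar> * \<bar>?\<sigma> - s\<bar> \<le> \<epsilon> * \<bar>?\<sigma> - s\<bar>" by (simp add: abs_mult)
    with \<open>s \<noteq> ?\<sigma>\<close> show ?thesis by simp
  qed
  then have "\<bar>D - E\<bar> \<le> 0" by (rule field_le_epsilon)
  then show ?thesis by simp
qed

lemma delta_deriv_eq: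
  assumes "has_delta_deriv T f D t" "t \<in> T" "d \<in> T" "t < d"
  shows "delta_deriv T f t = D"
  unfolding delta_deriv_def using assms has_delta_deriv_unique by (intro the_equality) blast+

section \<open>Continuity and mean value inequalities\<close>

text \<open>At a left-scattered maximum no derivative is available, but such a point is
  isolated.\<close>

lemma continuous_on_delta_differentiable:
  assumes "delta_differentiable T f"
  shows "continuous_on T f"
  unfolding continuous_on_def
proof
  fix t assume t: "t \<in> T"
  show "(f \<longlongrightarrow> f t) (at t within T)"
  proof (cases "t \<in> ts_kappa T")
    case True
    then obtain D where D: "has_delta_deriv T f D t"
      using assms by (auto simp: delta_differentiable_def)
    let ?\<sigma> = "fwd_jump T t"
    show ?thesis
    proof (rule tendstoI)
      fix e :: real assume "e > 0"
      \<comment> \<open>For |s - t| \<le> 1 the sum of \<open>\<bar>?\<sigma> - s\<bar>\<close> and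
        \<open>\<bar>?\<sigma> - t\<bar>\<close> is at most \<open>?K\<close>.\<close>
      let ?K = "2 * \<bar>?\<sigma> - t\<bar> + 1"
      let ?\<epsilon> = "e / 2 / ?K" and ?\<delta> = "min 1 (e / 2 / (\<bar>D\<bar> + 1))"
      have "?K > 0" by (rule add_nonneg_pos) auto
      then have "?\<epsilon> > 0" using \<open>e > 0\<close> by simp
      have "?\<delta> > 0" using \<open>e > 0\<close> by (simp add: add_nonneg_pos)
      note ev = has_delta_derivD[OF D \<open>?\<epsilon> > 0\<close>]
      then have at_t: "\<bar>f ?\<sigma> - f t - D * (?\<sigma> - t)\<bar> \<le> ?\<epsilon> * \<bar>?\<sigma> - t\<bar>"
        using t eventually_nhds_x_imp_x by blast
      have "\<forall>\<^sub>F s in nhds t. dist s t < ?\<delta>"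
        using \<open>?\<delta> > 0\<close> eventually_nhds_metric by blast
      with ev have "\<forall>\<^sub>F s in nhds t. s \<in> T \<longrightarrow> dist (f s) (f t) < e"
      proof eventually_elim
        case (elim s)
        show ?case
        proof
          assume "s \<in> T"
          have 1: "\<bar>f ?\<sigma> - f s - D * (?\<sigma> - s)\<bar> \<le> ?\<epsilon> * \<bar>?\<sigma> - s\<bar>" using elim \<open>s \<in> T\<close> by blast
          have "\<bar>t - s\<bar> < e / 2 / (\<bar>D\<bar> + 1)" "\<bar>t - s\<bar> \<le> 1"
            using elim(2) by (auto simp: dist_real_def)
          then have "\<bar>t - s\<bar> * (\<bar>D\<bar> + 1) < e / 2"
            by (subst (asm) pos_less_divide_eq) (auto intro: add_nonneg_pos)
          moreover have "\<bar>D * (t - s)\<bar> \<le> \<bar>t - s\<bar> * (\<bar>D\<bar> + 1)"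
            by (simp add: abs_mult distrib_left mult.commute)
          ultimately have 2: "\<bar>D * (t - s)\<bar> < e / 2" by linarith
          \<comment> \<open>Subtracting the estimate at \<open>t\<close> from that at
            \<open>s\<close> eliminates \<open>f ?\<sigma>\<close>, so a gap after \<open>t\<close>
            does no harm.\<close>
          have "f t - f s = (f ?\<sigma> - f s - D * (?\<sigma> - s)) - (f ?\<sigma> - f t - D * (?\<sigma> - t)) + D * (t - s)"
            by (simp add: algebra_simps)
          then have "\<bar>f t - f s\<bar> < ?\<epsilon> * \<bar>?\<sigma> - s\<bar> + ?\<epsilon> * \<bar>?\<sigma> - t\<bar> + e / 2"
            using 1 2 at_t by linarith
          also have "?\<epsilon> * \<bar>?\<sigma> - s\<bar> + ?\<epsilon> * \<bar>?\<sigma> - t\<bar> = ?\<epsilon> * (\<bar>?\<sigma> - s\<bar> + \<bar>?\<sigma> - t\<bar>)"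
            by (rule distrib_left[symmetric])
          also have "\<dots> \<le> ?\<epsilon> * ?K"
            using \<open>?\<epsilon> > 0\<close> \<open>\<bar>t - s\<bar> \<le> 1\<close> by (intro mult_left_mono) auto
          also have "\<dots> = e / 2" using \<open>?K > 0\<close> by (metis less_irrefl nonzero_eq_divide_eq)
          finally show "dist (f s) (f t) < e" by (simp add: dist_real_def abs_minus_commute)
        qed
      qed
      then show "\<forall>\<^sub>F s in at t within T. dist (f s) (f t) < e"
        unfolding eventually_at_filter by (auto elim: eventually_mono)
    qed
  next
    case False
    then have m: "left_scattered_max T t" using t by (simp add: ts_kappa_def)
    have "\<forall>\<^sub>F s in nhds t. Sup {s \<in> T. s < t} < s"
      using m by (intro order_tendstoD) (auto simp: left_scattered_max_def filterlim_ident)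
    then have "\<forall>\<^sub>F s in nhds t. s \<noteq> t \<longrightarrow> s \<in> T \<longrightarrow> False"
    proof eventually_elim
      case (elim s)
      have "s \<le> Sup {s \<in> T. s < t}" if "s \<in> T" "s < t"
        using that by (intro cSup_upper) (auto intro!: bdd_aboveI[of _ t])
      with elim m show ?case by (force simp: left_scattered_max_def)
    qed
    then have "at t within T = bot"
      by (simp add: eventually_at_filter flip: eventually_False)
    then show ?thesis by simp
  qed
qed

text \<open>The slack \<open>+ \<epsilon>\<close> in the bound that is propagated lets continuity replace the derivative
  at \<open>c\<close> when \<open>c\<close> is right-dense.\<close>

lemma delta_deriv_nonpos_imp_le:
  assumes T: "closed T" and c: "c \<in> T" and d: "d \<in> T" and "c \<le> d"
    and cont: "continuous_on T H"
    and der: "\<And>t. t \<in> T \<Longrightarrow> c \<le> t \<Longrightarrow> t < d \<Longrightarrow> c < t \<or> t < fwd_jump T t \<Longrightarrow>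
                \<exists>D\<le>0. has_delta_deriv T H D t"
  shows "H d \<le> H c"
proof -
  have key: "H d \<le> H c + \<epsilon> * (d - c) + \<epsilon>" if "\<epsilon> > 0" for \<epsilon>
  proof -
    define ok where "ok s \<longleftrightarrow> H s \<le> H c + \<epsilon> * (s - c) + \<epsilon>" for s
    \<comment> \<open>Induction along \<open>T\<close>: if the supremum of the points up to which
      the bound holds were below \<open>d\<close>, the bound could be carried on, across a gap or to
      nearby points on the right.\<close>
    define A where "A = {t \<in> T. c \<le> t \<and> t \<le> d \<and> (\<forall>s\<in>T. c \<le> s \<and> s \<le> t \<longrightarrow> ok s)}"
    define m where "m = Sup A"
    have "c \<in> A" using c \<open>c \<le> d\<close> \<open>\<epsilon> > 0\<close> by (auto simp: A_def ok_def)
    have bdd: "bdd_above A" by (auto simp: A_def intro!: bdd_aboveI[of _ d])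
    have mA: "m \<in> closure A" unfolding m_def using \<open>c \<in> A\<close> bdd by (intro closure_contains_Sup) auto
    have "closure A \<subseteq> T \<inter> {c..d}" using T by (intro closure_minimal) (auto simp: A_def)
    with mA have m: "m \<in> T" "c \<le> m" "m \<le> d" by auto
    have below: "ok s" if "s \<in> T" "c \<le> s" "s < m" for s
    proof -
      obtain t where "t \<in> A" "s < t"
        using \<open>s < m\<close> \<open>c \<in> A\<close> bdd unfolding m_def by (subst (asm) less_cSup_iff) auto
      then show ?thesis using that by (auto simp: A_def)
    qed
    have "closed {s \<in> T. H s \<le> H c + \<epsilon> * (s - c) + \<epsilon>}"
      using T cont by (intro continuous_on_closed_Collect_le continuous_intros) auto
    moreover have "A \<subseteq> {s \<in> T. H s \<le> H c + \<epsilon> * (s - c) + \<epsilon>}" by (auto simp: A_def ok_def)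
    ultimately have "ok m" using mA closure_minimal unfolding ok_def by blast
    have upto: "ok s" if "s \<in> T" "c \<le> s" "s \<le> m" for s
      using below that \<open>ok m\<close> by (cases "s = m") auto
    have leA: "t \<le> m" if "t \<in> A" for t using that bdd unfolding m_def by (rule cSup_upper)
    have "m = d"
    proof (rule ccontr)
      assume "m \<noteq> d"
      then have "m < d" using m by simp
      let ?\<sigma> = "fwd_jump T m"
      consider "m < ?\<sigma>" | "?\<sigma> = m" "c < m" | "?\<sigma> = m" "c = m"
        using fwd_jump_ge[of m T] m by linarith
      then show False
      proof cases
        case 1
        then obtain D where "D \<le> 0" and D: "has_delta_deriv T H D m" using der m \<open>m < d\<close> by blast
        \<comment> \<open>The estimate is taken at the point s = m itself, where it controls the
          whole jump.\<close>
        have "\<bar>H ?\<sigma> - H m - D * (?\<sigma> - m)\<bar> \<le> \<epsilon> * \<bar>?\<sigma> - m\<bar>"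
          using has_delta_derivD[OF D \<open>\<epsilon> > 0\<close>] eventually_nhds_x_imp_x m by blast
        moreover have "D * (?\<sigma> - m) \<le> 0" using \<open>D \<le> 0\<close> 1 by (simp add: mult_nonpos_nonneg)
        ultimately have "H ?\<sigma> \<le> H m + \<epsilon> * (?\<sigma> - m)" using 1 by simp
        then have "ok ?\<sigma>" using \<open>ok m\<close> by (simp add: ok_def algebra_simps)
        moreover have "ok s" if "s \<in> T" "c \<le> s" "s < ?\<sigma>" for s
          using upto that fwd_jump_le[of s T m] by force
        ultimately have "?\<sigma> \<in> A"
          using fwd_jump_in[OF T m(1)] m(2) 1 fwd_jump_le[OF d \<open>m < d\<close>]
          by (force simp: A_def order_le_less)
        with leA 1 show False by force
      next
        case 2
        then obtain D where "D \<le> 0" and D: "has_delta_deriv T H D m" using der m \<open>m < d\<close> by blast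
        obtain \<delta> where "\<delta> > 0" and
          \<delta>: "\<And>s. dist s m < \<delta> \<Longrightarrow> s \<in> T \<Longrightarrow> \<bar>H m - H s - D * (m - s)\<bar> \<le> \<epsilon> * \<bar>m - s\<bar>"
          using has_delta_derivD[OF D \<open>\<epsilon> > 0\<close>] 2 unfolding eventually_nhds_metric by auto
        obtain r where r: "r \<in> T" "m < r" "r < m + \<delta>" "r \<le> d"
          using right_dense_point[OF d \<open>m < d\<close>] 2 \<open>\<delta> > 0\<close> by (metis less_add_same_cancel1)
        have "ok s" if "s \<in> T" "m < s" "s \<le> r" for s
        proof -
          have "\<bar>H m - H s - D * (m - s)\<bar> \<le> \<epsilon> * (s - m)"
            using \<delta>[of s] that r by (simp add: dist_real_def)
          moreover have "D * (m - s) \<ge> 0" using \<open>D \<le> 0\<close> that by (simp add: mult_nonpos_nonpos)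
          ultimately have "H s \<le> H m + \<epsilon> * (s - m)" by linarith
          then show ?thesis using \<open>ok m\<close> by (simp add: ok_def algebra_simps)
        qed
        then have "r \<in> A" using r m upto unfolding A_def by force
        with leA r show False by force
      next
        case 3
        obtain \<delta> where "\<delta> > 0" and \<delta>: "\<And>s. s \<in> T \<Longrightarrow> dist s m < \<delta> \<Longrightarrow> dist (H s) (H m) < \<epsilon>"
          using cont m \<open>\<epsilon> > 0\<close> unfolding continuous_on_iff by metis
        obtain r where r: "r \<in> T" "m < r" "r < m + \<delta>" "r \<le> d"
          using right_dense_point[OF d \<open>m < d\<close>] 3 \<open>\<delta> > 0\<close> by (metis less_add_same_cancel1)
        have "ok s" if "s \<in> T" "m < s" "s \<le> r" for s
        proof -
          have "\<bar>H s - H m\<bar> < \<epsilon>" using \<delta>[of s] that r by (simp add: dist_real_def)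
          moreover have "\<epsilon> * (s - c) \<ge> 0" using that 3 \<open>\<epsilon> > 0\<close> by simp
          ultimately show ?thesis using 3 by (simp add: ok_def)
        qed
        then have "r \<in> A" using r m upto unfolding A_def by force
        with leA r show False by force
      qed
    qed
    with \<open>ok m\<close> show ?thesis by (simp add: ok_def)
  qed
  have "H d \<le> H c + e" if "e > 0" for e
  proof -
    have "e / (d - c + 1) > 0" using that \<open>c \<le> d\<close> by simp
    from key[OF this] have "H d \<le> H c + e / (d - c + 1) * (d - c + 1)" by (simp add: distrib_left)
    then show ?thesis using \<open>c \<le> d\<close> by simp
  qed
  then show ?thesis by (rule field_le_epsilon)
qed

lemma delta_deriv_le_imp_diff_le:
  assumes "closed T" "c \<in> T" "d \<in> T" "c \<le> d" "continuous_on T H"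
    and der: "\<And>t. t \<in> T \<Longrightarrow> c \<le> t \<Longrightarrow> t < d \<Longrightarrow> \<exists>D\<le>M. has_delta_deriv T H D t"
  shows "H d - H c \<le> M * (d - c)"
proof -
  have "H d - M * d \<le> H c - M * c"
  proof (rule delta_deriv_nonpos_imp_le[OF assms(1-4), of "\<lambda>s. H s - M * s"])
    show "continuous_on T (\<lambda>s. H s - M * s)" using assms(5) by (intro continuous_intros)
    fix t assume "t \<in> T" "c \<le> t" "t < d"
    with der obtain D where "D \<le> M" "has_delta_deriv T H D t" by blast
    with has_delta_deriv_diff[OF this(2) has_delta_deriv_cmult[OF has_delta_deriv_ident, where c = M]]
    show "\<exists>D\<le>0. has_delta_deriv T (\<lambda>s. H s - M * s) D t" by (intro exI[of _ "D - M"]) auto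
  qed
  then show ?thesis by (simp add: algebra_simps)
qed

lemma delta_deriv_zero_imp_eq:
  assumes "closed T" "c \<in> T" "d \<in> T" "c \<le> d" "continuous_on T H"
    and der: "\<And>t. t \<in> T \<Longrightarrow> c \<le> t \<Longrightarrow> t < d \<Longrightarrow> has_delta_deriv T H 0 t"
  shows "H d = H c"
proof -
  have "H d - H c \<le> 0 * (d - c)"
    by (rule delta_deriv_le_imp_diff_le[OF assms(1-5)]) (use der in auto)
  moreover have "- H d - - H c \<le> 0 * (d - c)"
    using has_delta_deriv_cmult[OF der, of _ "-1"] assms(5)
    by (intro delta_deriv_le_imp_diff_le[OF assms(1-4)] continuous_intros) fastforce+
  ultimately show ?thesis by simp
qed

section \<open>Independence of the integral from the antiderivative\<close>

lemma delta_antideriv_imp_differentiable: "delta_antideriv T F g \<Longrightarrow> delta_differentiable T F"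
  by (auto simp: delta_antideriv_def delta_differentiable_def)

text \<open>The difference of two antiderivatives has derivative zero, hence is constant on
  \<open>T\<close>; this resolves the definite description in the integral.\<close>

lemma delta_integral_eq:
  assumes T: "closed T" and F: "delta_antideriv T F g" and "c \<in> T" "d \<in> T"
  shows "delta_integral T g c d = F d - F c"
proof -
  have le: "G d - G c = F d - F c" if G: "delta_antideriv T G g" and "c \<in> T" "d \<in> T" "c \<le> d" for G c d
  proof -
    have "continuous_on T F" "continuous_on T G"
      using F G delta_antideriv_imp_differentiable continuous_on_delta_differentiable by blast+
    moreover have diff0: "has_delta_deriv T (\<lambda>s. G s - F s) 0 t" if "t \<in> ts_kappa T" for t
      using has_delta_deriv_diff[of T G "g t" t F "g t"] F G that by (simp add: delta_antideriv_def)
    ultimately have "G d - F d = G c - F c"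
      using ts_kappaI[of _ T d] \<open>d \<in> T\<close>
      by (intro delta_deriv_zero_imp_eq[OF T \<open>c \<in> T\<close> \<open>d \<in> T\<close> \<open>c \<le> d\<close>, of "\<lambda>s. G s - F s"]
           continuous_intros diff0) auto
    then show ?thesis by simp
  qed
  \<comment> \<open>The reversed order matters: h_2(x_i, \<alpha>_{i+1}) integrates backwards from
    \<alpha>_{i+1} to x_i.\<close>
  have "G d - G c = F d - F c" if "delta_antideriv T G g" for G
    using le[OF that, of c d] le[OF that, of d c] assms(3,4) by linarith
  then show ?thesis unfolding delta_integral_def using F by (intro the_equality) blast+
qed

section \<open>Antiderivatives\<close>

lemma fwd_jump_comp_integrable:
  fixes \<phi> :: "real \<Rightarrow> real"
  assumes "continuous_on UNIV \<phi>"
  shows "(\<lambda>u. \<phi> (fwd_jump T u)) integrable_on {c..d}"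
proof -
  have "(\<lambda>u. \<phi> (fwd_jump T u)) \<in> borel_measurable borel"
    using borel_measurable_mono[OF mono_fwd_jump] borel_measurable_continuous_onI[OF assms]
    by (rule measurable_compose)
  then have meas: "(\<lambda>u. \<phi> (fwd_jump T u)) \<in> borel_measurable (lebesgue_on {c..d})"
    by (simp add: measurable_completion measurable_restrict_space1)
  have "bounded (\<phi> ` {fwd_jump T c..fwd_jump T d})"
    by (intro compact_imp_bounded compact_continuous_image continuous_on_subset[OF assms]) auto
  then obtain B where "\<And>r. r \<in> {fwd_jump T c..fwd_jump T d} \<Longrightarrow> norm (\<phi> r) \<le> B"
    unfolding bounded_iff by blast
  then have "norm (\<phi> (fwd_jump T u)) \<le> B" if "u \<in> {c..d}" for u
    using that monoD[OF mono_fwd_jump] by simp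
  then show ?thesis
    by (intro measurable_bounded_by_integrable_imp_integrable[OF meas, of "\<lambda>_. B"]) auto
qed

lemma fwd_jump_antiderivative:
  assumes T: "closed T" and cont: "continuous_on UNIV \<phi>"
  obtains F where "\<And>t. t \<in> T \<Longrightarrow> has_delta_deriv T F (\<phi> (fwd_jump T t)) t"
proof -
  define G where "G u = \<phi> (fwd_jump T u)" for u
  \<comment> \<open>The integral from 0 to t with its sign: one of the two intervals is empty or a
    single point.\<close>
  define F where "F t = integral {0..t} G - integral {t..0} G" for t
  have int: "G integrable_on {c..d}" for c d
    unfolding G_def by (rule fwd_jump_comp_integrable[OF cont])
  have F_diff: "F t - F s = integral {s..t} G" if "s \<le> t" for s t
  proof -
    consider "t \<le> 0" | "s \<le> 0" "0 \<le> t" | "0 \<le> s" by linarith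
    then show ?thesis
    proof cases
      case 1
      have "integral {s..t} G + integral {t..0} G = integral {s..0} G"
        using that 1 int by (intro Henstock_Kurzweil_Integration.integral_combine) auto
      then show ?thesis using that 1 by (cases "t = 0"; cases "s = 0") (auto simp: F_def)
    next
      case 2
      have "integral {s..0} G + integral {0..t} G = integral {s..t} G"
        using that 2 int by (intro Henstock_Kurzweil_Integration.integral_combine) auto
      then show ?thesis using that 2 by (cases "t = 0"; cases "s = 0") (auto simp: F_def)
    next
      case 3
      have "integral {0..s} G + integral {s..t} G = integral {0..t} G"
        using that 3 int by (intro Henstock_Kurzweil_Integration.integral_combine) auto
      then show ?thesis using that 3 by (cases "t = 0"; cases "s = 0") (auto simp: F_def)
    qed
  qed
  \<comment> \<open>The right end point is left out because \<open>G\<close> may take another value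
    at the end of a gap; one point does not affect the integral.\<close>
  have bound: "\<bar>F t - F s - C * (t - s)\<bar> \<le> e * (t - s)"
    if "s \<le> t" "e \<ge> 0" "\<And>u. s \<le> u \<Longrightarrow> u < t \<Longrightarrow> \<bar>G u - C\<bar> \<le> e" for s t C e
  proof -
    have "((\<lambda>u. G u - C) has_integral (integral {s..t} G - C * (t - s))) {s..t}"
      using has_integral_diff[OF integrable_integral[OF int] has_integral_const_real[of C s t]] that
      by (simp add: mult.commute)
    then have "norm (integral {s..t} G - C * (t - s)) \<le> e * measure lborel {s..t}"
      using that by (intro has_integral_bound_real[of e "{t}"]) auto
    then show ?thesis using that F_diff by simp
  qed
  have "has_delta_deriv T F (\<phi> (fwd_jump T t)) t" if t: "t \<in> T" for t
    unfolding has_delta_deriv_iff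
  proof (intro allI impI)
    fix \<epsilon> :: real assume "\<epsilon> > 0"
    let ?\<sigma> = "fwd_jump T t"
    show "\<forall>\<^sub>F s in nhds t. s \<in> T \<longrightarrow> \<bar>F ?\<sigma> - F s - \<phi> ?\<sigma> * (?\<sigma> - s)\<bar> \<le> \<epsilon> * \<bar>?\<sigma> - s\<bar>"
    proof (cases "?\<sigma> = t")
      case True
      obtain \<delta> where "\<delta> > 0" and \<delta>: "\<And>r. dist r t < \<delta> \<Longrightarrow> dist (\<phi> r) (\<phi> t) < \<epsilon>"
        using cont \<open>\<epsilon> > 0\<close> unfolding continuous_on_iff by blast
      show ?thesis unfolding eventually_nhds_metric
      proof (intro exI[of _ \<delta>] conjI allI impI \<open>\<delta> > 0\<close>)
        fix s assume s: "dist s t < \<delta>" "s \<in> T"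
        \<comment> \<open>Since \<open>max s t\<close> lies in \<open>T\<close>, the jump of
          \<open>u\<close> cannot pass it and stays within \<delta> of \<open>t\<close>.\<close>
        have close: "\<bar>G u - \<phi> t\<bar> \<le> \<epsilon>" if "min s t \<le> u" "u < max s t" for u
        proof -
          have "max s t \<in> T" using s t by (simp add: max_def)
          then have "fwd_jump T u \<le> max s t" using that by (intro fwd_jump_le) auto
          then have "dist (fwd_jump T u) t < \<delta>"
            using fwd_jump_ge[of u T] that s(1) by (simp add: dist_real_def min_def max_def split: if_splits)
          then show ?thesis using \<delta> unfolding G_def dist_real_def by fastforce
        qed
        show "\<bar>F ?\<sigma> - F s - \<phi> ?\<sigma> * (?\<sigma> - s)\<bar> \<le> \<epsilon> * \<bar>?\<sigma> - s\<bar>"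
        proof (cases "s \<le> t")
          case True
          then show ?thesis using bound[of s t \<epsilon> "\<phi> t"] close \<open>\<epsilon> > 0\<close> \<open>?\<sigma> = t\<close> by simp
        next
          case False
          then have "\<bar>F s - F t - \<phi> t * (s - t)\<bar> \<le> \<epsilon> * (s - t)"
            using bound[of t s \<epsilon> "\<phi> t"] close \<open>\<epsilon> > 0\<close> by simp
          moreover have "F t - F s - \<phi> t * (t - s) = - (F s - F t - \<phi> t * (s - t))"
            by (simp add: algebra_simps)
          ultimately show ?thesis using False \<open>?\<sigma> = t\<close> by simp
        qed
      qed
    next
      case False
      then have gap: "t < ?\<sigma>" using fwd_jump_ge[of t T] by simp
      have G_const: "G u = \<phi> ?\<sigma>" if "t \<le> u" "u < ?\<sigma>" for u
        unfolding G_def fwd_jump_const_on_gap[OF T t that] ..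
      have jump: "F ?\<sigma> - F t = \<phi> ?\<sigma> * (?\<sigma> - t)"
        using bound[of t ?\<sigma> 0 "\<phi> ?\<sigma>"] gap G_const by simp
      have "bounded (\<phi> ` {t - 1..t})"
        by (intro compact_imp_bounded compact_continuous_image continuous_on_subset[OF cont]) auto
      then obtain B where B: "\<And>r. r \<in> {t - 1..t} \<Longrightarrow> \<bar>\<phi> r\<bar> \<le> B" unfolding bounded_iff by fastforce
      define K where "K = B + \<bar>\<phi> ?\<sigma>\<bar> + 1"
      have "B \<ge> 0" using B[of t] by simp
      then have "K > 0" by (simp add: K_def add_nonneg_pos)
      \<comment> \<open>The increment over the gap is exact. The piece from \<open>s\<close> to
        \<open>t\<close> is only bounded by \<open>K * (t - s)\<close>, but the tolerance contains
        the fixed amount \<open>\<epsilon> * (?\<sigma> - t)\<close>, so a small \<delta> absorbs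
        it.\<close>
      define \<delta> where "\<delta> = min 1 (min (?\<sigma> - t) (\<epsilon> * (?\<sigma> - t) / K))"
      have "\<delta> > 0" using \<open>K > 0\<close> \<open>\<epsilon> > 0\<close> gap by (simp add: \<delta>_def)
      show ?thesis unfolding eventually_nhds_metric
      proof (intro exI[of _ \<delta>] conjI allI impI \<open>\<delta> > 0\<close>)
        fix s assume s: "dist s t < \<delta>" "s \<in> T"
        then have near: "\<bar>s - t\<bar> < 1" "\<bar>s - t\<bar> < ?\<sigma> - t" "\<bar>s - t\<bar> < \<epsilon> * (?\<sigma> - t) / K"
          by (auto simp: \<delta>_def dist_real_def)
        have "s \<le> t" using fwd_jump_le[of s T t] s near by force
        have "\<bar>G u - \<phi> ?\<sigma>\<bar> \<le> K" if "s \<le> u" "u < t" for u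
        proof -
          have "fwd_jump T u \<in> {t - 1..t}"
            using fwd_jump_ge[of u T] fwd_jump_le[of t T u] t that near by auto
          then show ?thesis using B[of "fwd_jump T u"] unfolding G_def K_def by linarith
        qed
        then have "\<bar>F t - F s - \<phi> ?\<sigma> * (t - s)\<bar> \<le> K * (t - s)"
          using \<open>s \<le> t\<close> \<open>K > 0\<close> by (intro bound) auto
        also have "\<dots> \<le> \<epsilon> * (?\<sigma> - t)"
          using near(3) \<open>K > 0\<close> \<open>s \<le> t\<close> by (simp add: pos_less_divide_eq mult.commute)
        also have "\<dots> \<le> \<epsilon> * \<bar>?\<sigma> - s\<bar>" using \<open>s \<le> t\<close> gap \<open>\<epsilon> > 0\<close> by simp
        also have "F t - F s - \<phi> ?\<sigma> * (t - s) = F ?\<sigma> - F s - \<phi> ?\<sigma> * (?\<sigma> - s)"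
          using jump by (simp add: algebra_simps)
        finally show "\<bar>F ?\<sigma> - F s - \<phi> ?\<sigma> * (?\<sigma> - s)\<bar> \<le> \<epsilon> * \<bar>?\<sigma> - s\<bar>" .
      qed
    qed
  qed
  then show ?thesis by (rule that)
qed

text \<open>\<open>f\<close> is known to be continuous only on \<open>T\<close>. A Tietze extension
  provides the integrand on the gaps, and its choice is invisible in the result because \<sigma>
  maps \<open>T\<close> into \<open>T\<close>.\<close>

lemma differentiable_fwd_jump_antiderivative:
  assumes T: "closed T" and f: "delta_differentiable T f"
  obtains F where "\<And>t. t \<in> T \<Longrightarrow> has_delta_deriv T F (f (fwd_jump T t)) t"
proof -
  obtain \<phi> where \<phi>: "continuous_on UNIV \<phi>" "\<And>t. t \<in> T \<Longrightarrow> \<phi> t = f t"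
    using Tietze_unbounded[of T f UNIV] continuous_on_delta_differentiable[OF f] T by auto
  obtain F where F: "\<And>t. t \<in> T \<Longrightarrow> has_delta_deriv T F (\<phi> (fwd_jump T t)) t"
    using fwd_jump_antiderivative[OF T \<phi>(1)] by blast
  show ?thesis
  proof
    fix t assume t: "t \<in> T"
    from F[OF t] \<phi>(2)[OF fwd_jump_in[OF T t]]
    show "has_delta_deriv T F (f (fwd_jump T t)) t" by simp
  qed
qed

text \<open>As a function of t, h_2(t, c) has derivative t - c; reversing its sign to the left of
  \<open>c\<close> yields |t - c|, and the two terms of the weight become a single
  increment.\<close>

lemma abs_diff_antiderivative:
  assumes T: "closed T" and c: "c \<in> T"
  obtains A where "\<And>t. t \<in> T \<Longrightarrow> has_delta_deriv T A \<bar>t - c\<bar> t"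
    and "\<And>s t. s \<in> T \<Longrightarrow> t \<in> T \<Longrightarrow> s \<le> c \<Longrightarrow> c \<le> t \<Longrightarrow> A t - A s = ts_h T 2 s c + ts_h T 2 t c"
proof -
  obtain F where F: "\<And>t. t \<in> T \<Longrightarrow> has_delta_deriv T F (fwd_jump T t) t"
    using fwd_jump_antiderivative[OF T continuous_on_id] by auto
  \<comment> \<open>The product rule for \<open>(t - c) * t\<close> gives (t - c) + \<sigma>(t), and
    \<open>F\<close> removes \<sigma>(t).\<close>
  define Q where "Q t = (t - c) * t - F t" for t
  have Q: "has_delta_deriv T Q (t - c) t" if "t \<in> T" for t
    using has_delta_deriv_diff[OF has_delta_deriv_affine_mult[OF has_delta_deriv_ident, where c = c] F[OF that]]
    by (simp add: Q_def[abs_def])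
  define A where "A t = (if t \<le> c then Q c - Q t else Q t - Q c)" for t
  have h1: "ts_h T (Suc 0) t c = t - c" if "t \<in> T" for t
    using delta_integral_eq[OF T _ c that, of "\<lambda>s. s" "\<lambda>_. 1"] has_delta_deriv_ident
    by (simp add: delta_antideriv_def)
  have h2: "ts_h T 2 t c = Q t - Q c" if "t \<in> T" for t
  proof -
    have "delta_antideriv T Q (\<lambda>\<tau>. ts_h T (Suc 0) \<tau> c)"
      unfolding delta_antideriv_def
    proof
      fix t assume "t \<in> ts_kappa T"
      then have "t \<in> T" by (simp add: ts_kappa_def)
      with h1 Q show "has_delta_deriv T Q (ts_h T (Suc 0) t c) t" by simp
    qed
    from delta_integral_eq[OF T this c that] show ?thesis by (simp add: numeral_2_eq_2)
  qed
  have A: "has_delta_deriv T A \<bar>t - c\<bar> t" if t: "t \<in> T" for t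
    unfolding has_delta_deriv_iff
  proof (intro allI impI)
    fix \<epsilon> :: real assume "\<epsilon> > 0"
    let ?\<sigma> = "fwd_jump T t"
    consider "t < c" | "t = c" | "c < t" by linarith
    then show "\<forall>\<^sub>F s in nhds t. s \<in> T \<longrightarrow> \<bar>A ?\<sigma> - A s - \<bar>t - c\<bar> * (?\<sigma> - s)\<bar> \<le> \<epsilon> * \<bar>?\<sigma> - s\<bar>"
    proof cases
      case 1
      \<comment> \<open>As \<open>c\<close> lies in \<open>T\<close>, no gap straddles the point
        where the two branches of \<open>A\<close> meet.\<close>
      then have "?\<sigma> \<le> c" using c by (intro fwd_jump_le)
      have "\<forall>\<^sub>F s in nhds t. s < c" using 1 by (intro order_tendstoD) (auto simp: filterlim_ident)
      with has_delta_derivD[OF Q[OF t] \<open>\<epsilon> > 0\<close>] show ?thesis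
      proof eventually_elim
        case (elim s)
        have "A ?\<sigma> - A s - \<bar>t - c\<bar> * (?\<sigma> - s) = - (Q ?\<sigma> - Q s - (t - c) * (?\<sigma> - s))"
          using 1 \<open>?\<sigma> \<le> c\<close> elim(2) by (simp add: A_def algebra_simps)
        then show ?case using elim(1) by (simp only: abs_minus_cancel)
      qed
    next
      case 2
      \<comment> \<open>For \<open>s\<close> on the other branch, the increment of \<open>A\<close>
        is twice the increment of \<open>Q\<close> from \<open>c\<close> minus the one from
        \<open>s\<close>: three errors in all.\<close>
      have "\<epsilon> / 3 > 0" using \<open>\<epsilon> > 0\<close> by simp
      note ev = has_delta_derivD[OF Q[OF t] this]
      then have at_t: "\<bar>Q ?\<sigma> - Q c\<bar> \<le> \<epsilon> / 3 * \<bar>?\<sigma> - c\<bar>"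
        using t 2 eventually_nhds_x_imp_x by fastforce
      have "?\<sigma> \<ge> c" using fwd_jump_ge 2 by blast
      from ev show ?thesis
      proof eventually_elim
        case (elim s)
        show ?case
        proof
          assume "s \<in> T"
          then have *: "\<bar>Q ?\<sigma> - Q s\<bar> \<le> \<epsilon> / 3 * \<bar>?\<sigma> - s\<bar>" using elim 2 by simp
          have A\<sigma>: "A ?\<sigma> = Q ?\<sigma> - Q c" using \<open>?\<sigma> \<ge> c\<close> by (simp add: A_def)
          have "\<bar>A ?\<sigma> - A s\<bar> \<le> \<epsilon> * \<bar>?\<sigma> - s\<bar>"
          proof (cases "s \<le> c")
            case True
            then have "A s = Q c - Q s" by (simp add: A_def)
            then have "A ?\<sigma> - A s = 2 * (Q ?\<sigma> - Q c) - (Q ?\<sigma> - Q s)" using A\<sigma> by simp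
            then have "\<bar>A ?\<sigma> - A s\<bar> \<le> 2 * \<bar>Q ?\<sigma> - Q c\<bar> + \<bar>Q ?\<sigma> - Q s\<bar>"
              by (metis abs_mult abs_numeral abs_triangle_ineq4)
            also have "\<dots> \<le> 2 * (\<epsilon> / 3 * \<bar>?\<sigma> - s\<bar>) + \<epsilon> / 3 * \<bar>?\<sigma> - s\<bar>"
            proof (intro add_mono mult_left_mono *)
              have "\<epsilon> / 3 * \<bar>?\<sigma> - c\<bar> \<le> \<epsilon> / 3 * \<bar>?\<sigma> - s\<bar>"
                using True \<open>?\<sigma> \<ge> c\<close> \<open>\<epsilon> > 0\<close> by (intro mult_left_mono) auto
              with at_t show "\<bar>Q ?\<sigma> - Q c\<bar> \<le> \<epsilon> / 3 * \<bar>?\<sigma> - s\<bar>" by linarith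
            qed simp
            finally show ?thesis by simp
          next
            case False
            then have "A s = Q s - Q c" by (simp add: A_def)
            then have "\<bar>A ?\<sigma> - A s\<bar> = \<bar>Q ?\<sigma> - Q s\<bar>" using A\<sigma> by simp
            also have "\<dots> \<le> \<epsilon> / 3 * \<bar>?\<sigma> - s\<bar>" by (rule *)
            also have "\<dots> \<le> \<epsilon> * \<bar>?\<sigma> - s\<bar>" using \<open>\<epsilon> > 0\<close> by (intro mult_right_mono) auto
            finally show ?thesis .
          qed
          then show "\<bar>A ?\<sigma> - A s - \<bar>t - c\<bar> * (?\<sigma> - s)\<bar> \<le> \<epsilon> * \<bar>?\<sigma> - s\<bar>" using 2 by simp
        qed
      qed
    next
      case 3
      then have "?\<sigma> > c" using fwd_jump_ge[of t T] by simp
      have "\<forall>\<^sub>F s in nhds t. c < s" using 3 by (intro order_tendstoD) (auto simp: filterlim_ident)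
      with has_delta_derivD[OF Q[OF t] \<open>\<epsilon> > 0\<close>] show ?thesis
      proof eventually_elim
        case (elim s)
        have "A ?\<sigma> - A s - \<bar>t - c\<bar> * (?\<sigma> - s) = Q ?\<sigma> - Q s - (t - c) * (?\<sigma> - s)"
          using 3 \<open>?\<sigma> > c\<close> elim(2) by (simp add: A_def)
        then show ?case using elim by simp
      qed
    qed
  qed
  moreover have "A t - A s = ts_h T 2 s c + ts_h T 2 t c" if "s \<in> T" "t \<in> T" "s \<le> c" "c \<le> t" for s t
    using that h2 by (cases "t = c") (auto simp: A_def)
  ultimately show ?thesis by (rule that)
qed

section \<open>The error as a linear functional\<close>

text \<open>The one-sided inequality for P - G and for -P - G. The last premise exempts a
  right-dense \<open>c\<close>, about which a supremum over an open interval gives no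
  information.\<close>

lemma abs_delta_deriv_le_imp_abs_diff_le:
  assumes "closed T" "c \<in> T" "d \<in> T" "c \<le> d" "continuous_on T P" "continuous_on T G"
    and der: "\<And>t. t \<in> T \<Longrightarrow> c \<le> t \<Longrightarrow> t < d \<Longrightarrow> c < t \<or> t < fwd_jump T t \<Longrightarrow>
                \<exists>D E. has_delta_deriv T P D t \<and> has_delta_deriv T G E t \<and> \<bar>D\<bar> \<le> E"
  shows "\<bar>P d - P c\<bar> \<le> G d - G c"
proof -
  have "r * P d - G d \<le> r * P c - G c" if "\<bar>r\<bar> = 1" for r
  proof (rule delta_deriv_nonpos_imp_le[OF assms(1-4), of "\<lambda>s. r * P s - G s"])
    show "continuous_on T (\<lambda>s. r * P s - G s)" using assms(5,6) by (intro continuous_intros)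
    fix t assume "t \<in> T" "c \<le> t" "t < d" "c < t \<or> t < fwd_jump T t"
    with der obtain D E where D: "has_delta_deriv T P D t" "has_delta_deriv T G E t" "\<bar>D\<bar> \<le> E"
      by blast
    have "\<bar>r * D\<bar> \<le> E" using D(3) that by (simp add: abs_mult)
    with has_delta_deriv_diff[OF has_delta_deriv_cmult[OF D(1), of r] D(2)]
    show "\<exists>D\<le>0. has_delta_deriv T (\<lambda>s. r * P s - G s) D t"
      by (intro exI[of _ "r * D - E"]) auto
  qed
  from this[of 1] this[of "-1"] show ?thesis by auto
qed

lemma delta_deriv_nonneg_imp_le:
  assumes "closed T" "c \<in> T" "d \<in> T" "c \<le> d" "continuous_on T G"
    and der: "\<And>t. t \<in> T \<Longrightarrow> c \<le> t \<Longrightarrow> t < d \<Longrightarrow> \<exists>E\<ge>0. has_delta_deriv T G E t"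
  shows "G c \<le> G d"
proof -
  have "\<bar>0 - 0\<bar> \<le> G d - G c"
  proof (rule abs_delta_deriv_le_imp_abs_diff_le[OF assms(1-4) _ assms(5), of "\<lambda>_. 0"])
    fix t assume "t \<in> T" "c \<le> t" "t < d"
    with der obtain E where "E \<ge> 0" "has_delta_deriv T G E t" by blast
    then show "\<exists>D E. has_delta_deriv T (\<lambda>_. 0) D t \<and> has_delta_deriv T G E t \<and> \<bar>D\<bar> \<le> E"
      by (intro exI[of _ 0] exI[of _ E]) (simp add: has_delta_deriv_const)
  qed simp
  then show ?thesis by simp
qed

text \<open>\<open>G\<close> is known to be constant only to the right of \<open>t\<close>; passing
  to \<open>{t..d} \<inter> T\<close> discards the left neighbours, and uniqueness of the derivative
  applies there.\<close>

lemma delta_deriv_const_imp_zero: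
  assumes closed: "closed T" and T: "t \<in> T" "d \<in> T" "t < d" and G: "has_delta_deriv T G D t"
    and const: "\<And>s. s \<in> T \<Longrightarrow> t \<le> s \<Longrightarrow> s \<le> d \<Longrightarrow> G s = G t"
  shows "D = 0"
proof -
  let ?S = "{t..d} \<inter> T"
  have "has_delta_deriv ?S G D t" using has_delta_deriv_restrict[OF G] T by simp
  moreover have "has_delta_deriv ?S G 0 t"
  proof -
    have "fwd_jump ?S t \<in> ?S" using closed T by (intro fwd_jump_in) auto
    then have "G (fwd_jump ?S t) = G t" using const by auto
    then show ?thesis using const by (auto simp: has_delta_deriv_iff)
  qed
  ultimately show ?thesis using has_delta_deriv_unique[of "{t..d} \<inter> T" G D t 0 d] T by auto
qed

text \<open>For n = k the boundary term at 0 vanishes because x_0 = \<alpha>_0, and the one at k is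
  the last summand of the quadrature sum because x_k = \<alpha>_{k+1}.\<close>

lemma summation_by_parts:
  fixes \<alpha> x f :: "nat \<Rightarrow> real"
  shows "(\<Sum>i<n. (x (i + 1) - \<alpha> (i + 1)) * f (i + 1) - (x i - \<alpha> (i + 1)) * f i)
       = (\<Sum>i<n. (\<alpha> (i + 1) - \<alpha> i) * f i) + (x n - \<alpha> n) * f n - (x 0 - \<alpha> 0) * f 0"
  by (induction n) (auto simp: algebra_simps)

section \<open>Montgomery identity and upper bound\<close>

locale subdivision =
  fixes T :: "real set" and a b :: real and k :: nat and x \<alpha> :: "nat \<Rightarrow> real"
  assumes closed_T: "closed T" and aT: "a \<in> T" and bT: "b \<in> T" and k: "k \<ge> 1"
    and xT: "\<And>i. i \<le> k \<Longrightarrow> x i \<in> T" and x0: "x 0 = a" and xk: "x k = b"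
    and x_less: "\<And>i. i < k \<Longrightarrow> x i < x (i + 1)"
    and \<alpha>T: "\<And>i. i \<le> k + 1 \<Longrightarrow> \<alpha> i \<in> T" and \<alpha>0: "\<alpha> 0 = a" and \<alpha>k: "\<alpha> (k + 1) = b"
    and \<alpha>x: "\<And>i. i < k \<Longrightarrow> x i \<le> \<alpha> (i + 1) \<and> \<alpha> (i + 1) \<le> x (i + 1)"
begin

abbreviation S :: "real set" where "S \<equiv> {a..b} \<inter> T"

abbreviation I :: "real set" where
  "I \<equiv> (if a < fwd_jump T a \<and> \<alpha> 1 \<noteq> a then {a..<b} else {a<..<b}) \<inter> T"

text \<open>The error with its sign, so that it is linear in \<open>f\<close>.\<close>

definition L :: "(real \<Rightarrow> real) \<Rightarrow> real" where
  "L f = delta_integral S (\<lambda>t. f (fwd_jump S t)) a b - (\<Sum>i=0..k. (\<alpha> (i + 1) - \<alpha> i) * f (x i))"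

definition w :: "nat \<Rightarrow> real" where
  "w i = ts_h T 2 (x i) (\<alpha> (i + 1)) + ts_h T 2 (x (i + 1)) (\<alpha> (i + 1))"

abbreviation W :: real where "W \<equiv> ostrowski_weight T k x \<alpha>"

lemma error_eq: "ostrowski_error T a b k x \<alpha> f = \<bar>L f\<bar>"
  by (simp add: ostrowski_error_def L_def)

lemma weight_eq: "W = (\<Sum>i<k. w i)"
  by (simp add: ostrowski_weight_def w_def)

lemma closed_S: "closed S"
  using closed_T by auto

lemma x_mono: "i \<le> j \<Longrightarrow> j \<le> k \<Longrightarrow> x i \<le> x j"
proof (induction j rule: dec_induct)
  case (step n)
  then show ?case using x_less[of n] by simp
qed simp

lemma xS: "i \<le> k \<Longrightarrow> x i \<in> S"
  using x_mono[of 0 i] x_mono[of i k] xT x0 xk by auto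

lemma \<alpha>S: "i < k \<Longrightarrow> \<alpha> (i + 1) \<in> S"
  using \<alpha>x[of i] \<alpha>T[of "i + 1"] xS[of i] xS[of "i + 1"] by auto

lemma ab: "a < b"
  using x_less[of 0] x_mono[of 1 k] k x0 xk by simp

lemma aS: "a \<in> S" and bS: "b \<in> S"
  using aT bT ab by auto

lemma jump_S: "t \<in> S \<Longrightarrow> t < b \<Longrightarrow> fwd_jump S t = fwd_jump T t"
  using fwd_jump_restrict bT by auto

lemma diff_S:
  assumes "delta_differentiable S f" "t \<in> S" "t < b"
  shows "has_delta_deriv S f (delta_deriv S f t) t"
proof -
  obtain D where "has_delta_deriv S f D t"
    using assms ts_kappaI[OF assms(2) bS] by (auto simp: delta_differentiable_def)
  with delta_deriv_eq[OF this assms(2) bS assms(3)] show ?thesis by simp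
qed

text \<open>The weight is formed in \<open>T\<close>, whereas \<open>f\<close> lives on
  \<open>S\<close>. The antiderivative is therefore built on \<open>T\<close> and restricted; below
  \<open>b\<close> both time scales have the same jumps.\<close>

lemma interval_antiderivative:
  assumes i: "i < k"
  obtains A where "\<And>t. t \<in> S \<Longrightarrow> t < b \<Longrightarrow> has_delta_deriv S A \<bar>t - \<alpha> (i + 1)\<bar> t"
    "continuous_on S A" "A (x (i + 1)) - A (x i) = w i"
proof -
  obtain A where A: "\<And>t. t \<in> T \<Longrightarrow> has_delta_deriv T A \<bar>t - \<alpha> (i + 1)\<bar> t"
    and *: "\<And>s t. s \<in> T \<Longrightarrow> t \<in> T \<Longrightarrow> s \<le> \<alpha> (i + 1) \<Longrightarrow> \<alpha> (i + 1) \<le> t \<Longrightarrow>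
               A t - A s = ts_h T 2 s (\<alpha> (i + 1)) + ts_h T 2 t (\<alpha> (i + 1))"
    using abs_diff_antiderivative[OF closed_T \<alpha>T[of "i + 1"]] i by auto
  show ?thesis
  proof
    show "has_delta_deriv S A \<bar>t - \<alpha> (i + 1)\<bar> t" if "t \<in> S" "t < b" for t
      using that A bT by (intro has_delta_deriv_restrict) auto
    have "delta_differentiable T A"
      using A by (auto simp: delta_differentiable_def ts_kappa_def)
    then show "continuous_on S A"
      using continuous_on_delta_differentiable continuous_on_subset by blast
    show "A (x (i + 1)) - A (x i) = w i"
      using i xT \<alpha>x[OF i] by (simp add: * w_def)
  qed
qed

text \<open>Stated for any known derivative \<open>D\<close> of \<open>f\<close>, it serves both the
  upper bound, with \<open>delta_deriv\<close>, and the near-extremal function, whose derivative is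
  prescribed.\<close>

lemma montgomery_identity:
  assumes f: "delta_differentiable S f"
  obtains P where "L f = - (\<Sum>i<k. P i (x (i + 1)) - P i (x i))"
    "\<And>i. continuous_on S (P i)"
    "\<And>i t D. has_delta_deriv S f D t \<Longrightarrow> t \<in> S \<Longrightarrow> t < b \<Longrightarrow>
        has_delta_deriv S (P i) ((t - \<alpha> (i + 1)) * D) t"
proof -
  have cont_f: "continuous_on S f" by (rule continuous_on_delta_differentiable[OF f])
  obtain F where F': "\<And>t. t \<in> S \<Longrightarrow> has_delta_deriv S F (f (fwd_jump S t)) t"
    using differentiable_fwd_jump_antiderivative[OF closed_S f] by blast
  then have anti: "delta_antideriv S F (\<lambda>t. f (fwd_jump S t))"
    by (simp add: delta_antideriv_def ts_kappa_def)
  define P where "P i t = (t - \<alpha> (i + 1)) * f t - F t" for i t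
  show ?thesis
  proof
    have "(\<Sum>i<k. P i (x (i + 1)) - P i (x i))
        = (\<Sum>i<k. ((x (i + 1) - \<alpha> (i + 1)) * f (x (i + 1)) - (x i - \<alpha> (i + 1)) * f (x i))
                   - (F (x (Suc i)) - F (x i)))"
      by (intro sum.cong) (auto simp: P_def)
    also have "\<dots> = (\<Sum>i<k. (x (i + 1) - \<alpha> (i + 1)) * f (x (i + 1)) - (x i - \<alpha> (i + 1)) * f (x i))
                   - (F b - F a)"
      using sum_lessThan_telescope[of "\<lambda>i. F (x i)" k] x0 xk
      by (simp only: sum_subtractf[of _ "\<lambda>i. F (x (Suc i)) - F (x i)"])
    also have "\<dots> = (\<Sum>i<k. (\<alpha> (i + 1) - \<alpha> i) * f (x i)) + (\<alpha> (k + 1) - \<alpha> k) * f (x k) - (F b - F a)"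
      using summation_by_parts[of x \<alpha> "\<lambda>i. f (x i)" k] x0 xk \<alpha>0 \<alpha>k by simp
    also have "\<dots> = (\<Sum>i=0..k. (\<alpha> (i + 1) - \<alpha> i) * f (x i)) - (F b - F a)"
      by (simp add: atLeast0AtMost lessThan_Suc_atMost[symmetric])
    finally show "L f = - (\<Sum>i<k. P i (x (i + 1)) - P i (x i))"
      using delta_integral_eq[OF closed_S anti aS bS] by (simp add: L_def)
    have "continuous_on S F"
      using delta_antideriv_imp_differentiable[OF anti] by (rule continuous_on_delta_differentiable)
    then show "continuous_on S (P i)" for i
      unfolding P_def using cont_f by (intro continuous_intros)
    show "has_delta_deriv S (P i) ((t - \<alpha> (i + 1)) * D) t"
      if "has_delta_deriv S f D t" "t \<in> S" "t < b" for i t D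
      using has_delta_deriv_diff[OF has_delta_deriv_affine_mult[OF that(1)] F'[OF that(2)], of "\<alpha> (i + 1)"]
      by (simp add: P_def[abs_def])
  qed
qed

lemma w_nonneg:
  assumes i: "i < k"
  shows "w i \<ge> 0"
proof -
  obtain A where A: "\<And>t. t \<in> S \<Longrightarrow> t < b \<Longrightarrow> has_delta_deriv S A \<bar>t - \<alpha> (i + 1)\<bar> t"
    "continuous_on S A" "A (x (i + 1)) - A (x i) = w i"
    using interval_antiderivative[OF i] by blast
  have "A (x i) \<le> A (x (i + 1))"
  proof (rule delta_deriv_nonneg_imp_le[OF closed_S _ _ _ A(2)])
    show "x i \<in> S" "x (i + 1) \<in> S" "x i \<le> x (i + 1)" using i xS x_less[OF i] by auto
    fix t assume "t \<in> S" "t < x (i + 1)"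
    moreover have "x (i + 1) \<le> b" using x_mono[of "i + 1" k] i xk by simp
    ultimately show "\<exists>E\<ge>0. has_delta_deriv S A E t" 
      using A(1)[of t] by (intro exI[of _ "\<bar>t - \<alpha> (i + 1)\<bar>"]) auto
  qed
  then show ?thesis using A(3) by simp
qed

lemma weight_nonneg: "W \<ge> 0"
  unfolding weight_eq using w_nonneg by (auto intro: sum_nonneg)

lemma error_le:
  assumes f: "delta_differentiable S f" and M: "\<And>t. t \<in> I \<Longrightarrow> \<bar>delta_deriv S f t\<bar> \<le> M"
  shows "\<bar>L f\<bar> \<le> M * W"
proof -
  obtain P where L: "L f = - (\<Sum>i<k. P i (x (i + 1)) - P i (x i))"
    and cont: "\<And>i. continuous_on S (P i)"
    and P: "\<And>i t D. has_delta_deriv S f D t \<Longrightarrow> t \<in> S \<Longrightarrow> t < b \<Longrightarrow>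
        has_delta_deriv S (P i) ((t - \<alpha> (i + 1)) * D) t"
    using montgomery_identity[OF f] by blast
  have "\<bar>P i (x (i + 1)) - P i (x i)\<bar> \<le> M * w i" if i: "i < k" for i
  proof -
    obtain A where A: "\<And>t. t \<in> S \<Longrightarrow> t < b \<Longrightarrow> has_delta_deriv S A \<bar>t - \<alpha> (i + 1)\<bar> t"
      "continuous_on S A" "A (x (i + 1)) - A (x i) = w i"
      using interval_antiderivative[OF i] by blast
    have "\<bar>P i (x (i + 1)) - P i (x i)\<bar> \<le> M * A (x (i + 1)) - M * A (x i)"
    proof (rule abs_delta_deriv_le_imp_abs_diff_le[OF closed_S _ _ _ cont, where G = "\<lambda>t. M * A t"])
      show "x i \<in> S" "x (i + 1) \<in> S" "x i \<le> x (i + 1)"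
        using i xS x_less[OF i] by auto
      show "continuous_on S (\<lambda>t. M * A t)" using A(2) by (intro continuous_intros)
      fix t assume t: "t \<in> S" "x i \<le> t" "t < x (i + 1)" "x i < t \<or> t < fwd_jump S t"
      then have "t < b" using x_mono[of "i + 1" k] i xk by simp
      \<comment> \<open>At t = \<alpha>_{i+1} both sides vanish, so the derivative of
        \<open>f\<close> need not be bounded there.\<close>
      have "\<bar>(t - \<alpha> (i + 1)) * delta_deriv S f t\<bar> \<le> M * \<bar>t - \<alpha> (i + 1)\<bar>"
      proof (cases "t = \<alpha> (i + 1)")
        case False
        \<comment> \<open>The case t = a forces i = 0; then a is right-scattered and differs from
          \<alpha> 1, which is exactly when \<open>I\<close> contains it.\<close>
        have "t \<in> I"
        proof (cases "t = a")
          case True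
          then have "x i = a" using t xS[of i] i by simp
          then have "i = 0" using x_less[of 0] x_mono[of 1 i] i x0 by (cases i) auto
          with False True t jump_S[OF t(1) \<open>t < b\<close>] \<open>x i = a\<close> ab show ?thesis by auto
        qed (use t \<open>t < b\<close> in auto)
        from M[OF this] show ?thesis
          unfolding abs_mult by (subst mult.commute) (intro mult_right_mono, auto)
      qed simp
      with P[OF diff_S[OF f t(1) \<open>t < b\<close>] t(1) \<open>t < b\<close>, of i]
        has_delta_deriv_cmult[OF A(1)[OF t(1) \<open>t < b\<close>], of M]
      show "\<exists>D E. has_delta_deriv S (P i) D t \<and> has_delta_deriv S (\<lambda>t. M * A t) E t \<and> \<bar>D\<bar> \<le> E"
        by blast
    qed
    then show ?thesis using A(3) by (simp flip: right_diff_distrib)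
  qed
  then have "(\<Sum>i<k. \<bar>P i (x (i + 1)) - P i (x i)\<bar>) \<le> (\<Sum>i<k. M * w i)"
    by (intro sum_mono) auto
  then have "\<bar>\<Sum>i<k. P i (x (i + 1)) - P i (x i)\<bar> \<le> (\<Sum>i<k. M * w i)"
    using sum_abs[of "\<lambda>i. P i (x (i + 1)) - P i (x i)" "{..<k}"] by linarith
  then show ?thesis by (simp add: L weight_eq sum_distrib_left)
qed

text \<open>Needed separately from \<open>error_le\<close> since the derivative may be unbounded.\<close>

lemma error_eq_0:
  assumes f: "delta_differentiable S f" and "W = 0"
  shows "L f = 0"
proof -
  obtain P where L: "L f = - (\<Sum>i<k. P i (x (i + 1)) - P i (x i))"
    and cont: "\<And>i. continuous_on S (P i)"
    and P: "\<And>i t D. has_delta_deriv S f D t \<Longrightarrow> t \<in> S \<Longrightarrow> t < b \<Longrightarrow>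
        has_delta_deriv S (P i) ((t - \<alpha> (i + 1)) * D) t"
    using montgomery_identity[OF f] by blast
  have "P i (x (i + 1)) - P i (x i) = 0" if i: "i < k" for i
  proof -
    have "w i = 0"
      using \<open>W = 0\<close> i w_nonneg unfolding weight_eq by (subst (asm) sum_nonneg_eq_0_iff) auto
    obtain A where A: "\<And>t. t \<in> S \<Longrightarrow> t < b \<Longrightarrow> has_delta_deriv S A \<bar>t - \<alpha> (i + 1)\<bar> t"
      "continuous_on S A" "A (x (i + 1)) - A (x i) = w i"
      using interval_antiderivative[OF i] by blast
    have xi: "x i \<in> S" "x (i + 1) \<in> S" "x i \<le> x (i + 1)" "x (i + 1) \<le> b"
      using i xS x_less[OF i] x_mono[of "i + 1" k] xk by auto
    have mono: "A s \<le> A t" if "s \<in> S" "t \<in> S" "s \<le> t" "t \<le> x (i + 1)" for s t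
    proof (rule delta_deriv_nonneg_imp_le[OF closed_S that(1-3) A(2)])
      fix r assume "r \<in> S" "r < t"
      then show "\<exists>E\<ge>0. has_delta_deriv S A E r" 
        using A(1)[of r] that xi(4) by (intro exI[of _ "\<bar>r - \<alpha> (i + 1)\<bar>"]) auto
    qed
    \<comment> \<open>A monotone \<open>A\<close> with zero total increment is constant, so its
      derivative |t - \<alpha>_{i+1}| vanishes, and with it that of \<open>P i\<close>, however
      large the derivative of \<open>f\<close> is.\<close>
    have const: "A s = A (x i)" if "s \<in> S" "x i \<le> s" "s \<le> x (i + 1)" for s
      using mono[OF xi(1) that(1)] mono[OF that(1) xi(2)] that A(3) \<open>w i = 0\<close> by simp
    have "P i (x (i + 1)) = P i (x i)"
    proof (rule delta_deriv_zero_imp_eq[OF closed_S xi(1-3) cont])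
      fix t assume t: "t \<in> S" "x i \<le> t" "t < x (i + 1)"
      then have "t < b" using xi by simp
      have "\<bar>t - \<alpha> (i + 1)\<bar> = 0"
        using t const by (intro delta_deriv_const_imp_zero[OF closed_S t(1) xi(2) t(3) A(1)[OF t(1) \<open>t < b\<close>]]) simp
      with P[OF diff_S[OF f t(1) \<open>t < b\<close>] t(1) \<open>t < b\<close>, of i]
      show "has_delta_deriv S (P i) 0 t" by simp
    qed
    then show ?thesis by simp
  qed
  then show ?thesis by (simp add: L)
qed

text \<open>Linearity of the integral requires antiderivatives of both integrands, since the
  definite description is unspecified without them; differentiability supplies them.\<close>

lemma L_add_cmult:
  assumes f: "delta_differentiable S f" and g: "delta_differentiable S g"
  shows "L (\<lambda>t. f t + c * g t) = L f + c * L g"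
proof -
  have ex: "\<exists>F. delta_antideriv S F (\<lambda>t. f (fwd_jump S t))" if diff: "delta_differentiable S f" for f
  proof -
    obtain F where "\<And>t. t \<in> S \<Longrightarrow> has_delta_deriv S F (f (fwd_jump S t)) t"
      using differentiable_fwd_jump_antiderivative[OF closed_S diff] by blast
    then have "delta_antideriv S F (\<lambda>t. f (fwd_jump S t))"
      by (simp add: delta_antideriv_def ts_kappa_def)
    then show ?thesis by (rule exI[of _ F])
  qed
  obtain F G where F: "delta_antideriv S F (\<lambda>t. f (fwd_jump S t))"
    and G: "delta_antideriv S G (\<lambda>t. g (fwd_jump S t))"
    using ex f g by blast
  have FG: "delta_antideriv S (\<lambda>t. F t + c * G t) (\<lambda>t. f (fwd_jump S t) + c * g (fwd_jump S t))"
    using F G by (simp add: delta_antideriv_def has_delta_deriv_add has_delta_deriv_cmult)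
  note eq = delta_integral_eq[OF closed_S _ aS bS]
  have "(\<Sum>i=0..k. (\<alpha> (i + 1) - \<alpha> i) * (f (x i) + c * g (x i)))
      = (\<Sum>i=0..k. (\<alpha> (i + 1) - \<alpha> i) * f (x i)) + c * (\<Sum>i=0..k. (\<alpha> (i + 1) - \<alpha> i) * g (x i))"
    unfolding sum_distrib_left sum.distrib[symmetric] by (intro sum.cong refl) algebra
  moreover have "(F b + c * G b) - (F a + c * G a) = (F b - F a) + c * (G b - G a)" by algebra
  ultimately show ?thesis
    unfolding L_def eq[OF F] eq[OF G] eq[OF FG] by (simp only: right_diff_distrib)
qed

end

section \<open>Sharpness\<close>

lemma delta_differentiable_add_cmult:
  assumes "delta_differentiable T f" "delta_differentiable T g"
  shows "delta_differentiable T (\<lambda>t. f t + c * g t)"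
  unfolding delta_differentiable_def
proof
  fix t assume "t \<in> ts_kappa T"
  with assms obtain D E where "has_delta_deriv T f D t" "has_delta_deriv T g E t"
    unfolding delta_differentiable_def by blast
  then show "\<exists>D. has_delta_deriv T (\<lambda>t. f t + c * g t) D t"
    by (intro exI[of _ "D + c * E"] has_delta_deriv_add has_delta_deriv_cmult)
qed

context subdivision
begin

lemma delta_deriv_add_cmult:
  assumes "delta_differentiable S f" "delta_differentiable S g" "t \<in> S" "t < b"
  shows "delta_deriv S (\<lambda>t. f t + c * g t) t = delta_deriv S f t + c * delta_deriv S g t"
  using assms diff_S bS
  by (intro delta_deriv_eq[where d = b] has_delta_deriv_add has_delta_deriv_cmult) auto

section \<open>A continuous approximation of the sign\<close>

definition clamp :: "real \<Rightarrow> real" where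
  "clamp r = max 0 (min 1 r)"

text \<open>As \<open>\<eta> \<rightarrow> 0\<close>, \<open>sign_approx \<eta> \<circ> \<sigma>\<close> approximates the sign of \<open>t - \<alpha>\<^sub>i\<^sub>+\<^sub>1\<close> on \<open>[x\<^sub>i, x\<^sub>i\<^sub>+\<^sub>1)\<close>. All ramps
  lie to the right of the jumps: the points \<open>t \<ge> c\<close> with \<open>\<sigma>(t) < c + \<eta>\<close> have small measure,
  whereas a point to the left of \<open>c + \<eta>\<close> may be followed by a large gap.\<close>

definition sign_approx :: "real \<Rightarrow> real \<Rightarrow> real" where
  "sign_approx \<eta> s =
     1 - 2 * min 1 (\<Sum>j<k. min (clamp ((s - x j) / \<eta>)) (clamp ((\<alpha> (j + 1) + \<eta> - s) / \<eta>)))"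

lemma continuous_sign_approx: "continuous_on UNIV (sign_approx \<eta>)"
  unfolding sign_approx_def[abs_def] clamp_def divide_inverse by (intro continuous_intros)

lemma clamp_nonneg: "clamp r \<ge> 0" and clamp_eq_0: "r \<le> 0 \<Longrightarrow> clamp r = 0"
  and clamp_eq_1: "r \<ge> 1 \<Longrightarrow> clamp r = 1"
  by (auto simp: clamp_def)

lemma abs_sign_approx_le: "\<bar>sign_approx \<eta> s\<bar> \<le> 1"
proof -
  have "(\<Sum>j<k. min (clamp ((s - x j) / \<eta>)) (clamp ((\<alpha> (j + 1) + \<eta> - s) / \<eta>))) \<ge> 0"
    by (intro sum_nonneg) (simp add: clamp_nonneg)
  moreover have "\<bar>1 - 2 * min 1 r\<bar> \<le> 1" if "r \<ge> 0" for r :: real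
    using that by (simp add: min_def abs_le_iff)
  ultimately show ?thesis unfolding sign_approx_def by blast
qed

text \<open>The crude price paid where the approximation has not yet settled.\<close>

lemma abs_minus_mult_sign_approx_le:
  assumes "\<bar>r\<bar> \<le> B"
  shows "\<bar>r\<bar> - r * sign_approx \<eta> s \<le> 2 * B"
proof -
  have "\<bar>r * sign_approx \<eta> s\<bar> \<le> \<bar>r\<bar> * 1"
    unfolding abs_mult by (intro mult_left_mono abs_sign_approx_le) auto
  then show ?thesis using assms by linarith
qed

text \<open>The bump with index \<open>i\<close> equals 1 here. Neighbouring bumps can overlap, and
  the cap at 1 absorbs the excess.\<close>

lemma sign_approx_left:
  assumes "\<eta> > 0" "i < k" "x i + \<eta> \<le> s" "s \<le> \<alpha> (i + 1)"
  shows "sign_approx \<eta> s = -1"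
proof -
  let ?\<psi> = "\<lambda>j. min (clamp ((s - x j) / \<eta>)) (clamp ((\<alpha> (j + 1) + \<eta> - s) / \<eta>))"
  have "1 \<le> (s - x i) / \<eta>" "1 \<le> (\<alpha> (i + 1) + \<eta> - s) / \<eta>"
    using assms by (simp_all add: pos_le_divide_eq)
  then have "?\<psi> i = 1" by (simp only: clamp_eq_1)
  then have "1 \<le> sum ?\<psi> {..<k}"
    using member_le_sum[of i "{..<k}" ?\<psi>] assms(2) by (simp add: clamp_nonneg)
  then have "min 1 (sum ?\<psi> {..<k}) = 1" by (rule min_absorb1)
  then show ?thesis unfolding sign_approx_def by simp
qed

text \<open>All bumps vanish: those with j \<le> i have ended, the earlier ones because
  \<alpha>_{j+1} \<le> x_i, and those with j > i start at x_{i+1} or later.\<close>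

lemma sign_approx_right:
  assumes "\<eta> > 0" "i < k" "x i + \<eta> \<le> s" "\<alpha> (i + 1) + \<eta> \<le> s" "s \<le> x (i + 1)"
  shows "sign_approx \<eta> s = 1"
proof -
  let ?\<psi> = "\<lambda>j. min (clamp ((s - x j) / \<eta>)) (clamp ((\<alpha> (j + 1) + \<eta> - s) / \<eta>))"
  have "?\<psi> j = 0" if "j < k" for j
  proof (cases "j \<le> i")
    case True
    have "\<alpha> (j + 1) + \<eta> \<le> s"
    proof (cases "j = i")
      case False
      then have "x (j + 1) \<le> x i" using True assms(2) by (intro x_mono) auto
      then show ?thesis using \<alpha>x[OF that] assms(3) by simp
    qed (use assms in simp)
    then have "(\<alpha> (j + 1) + \<eta> - s) / \<eta> \<le> 0" using assms(1) by (simp add: divide_le_0_iff)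
    then have "clamp ((\<alpha> (j + 1) + \<eta> - s) / \<eta>) = 0" by (rule clamp_eq_0)
    then show ?thesis by (simp only: min_absorb2[OF clamp_nonneg])
  next
    case False
    then have "x (i + 1) \<le> x j" using that by (intro x_mono) auto
    then have "(s - x j) / \<eta> \<le> 0" using assms by (simp add: divide_le_0_iff)
    then have "clamp ((s - x j) / \<eta>) = 0" by (rule clamp_eq_0)
    then show ?thesis by (simp only: min_absorb1[OF clamp_nonneg])
  qed
  then have "sum ?\<psi> {..<k} = 0" by (intro sum.neutral) auto
  then show ?thesis unfolding sign_approx_def by simp
qed

lemma near_extremal:
  assumes "\<epsilon> > 0"
  obtains h where "delta_differentiable S h" "\<And>t. t \<in> S \<Longrightarrow> t < b \<Longrightarrow> \<bar>delta_deriv S h t\<bar> \<le> 1"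
    "W - \<epsilon> < \<bar>L h\<bar>"
proof -
  \<comment> \<open>Each of the \<open>k\<close> intervals will lose at most
    \<open>4 * \<eta> * (b - a)\<close>, which adds up to \<epsilon> / 2.\<close>
  define \<eta> where "\<eta> = \<epsilon> / (8 * real k * (b - a))"
  have kba: "real k * (b - a) > 0" using ab k by simp
  then have \<eta>: "\<eta> > 0" using \<open>\<epsilon> > 0\<close> by (simp add: \<eta>_def mult.assoc)
  obtain h where h: "\<And>t. t \<in> S \<Longrightarrow> has_delta_deriv S h (sign_approx \<eta> (fwd_jump S t)) t"
    using fwd_jump_antiderivative[OF closed_S continuous_sign_approx] by blast
  have diff: "delta_differentiable S h"
    using h by (auto simp: delta_differentiable_def ts_kappa_def)
  obtain P where L: "L h = - (\<Sum>i<k. P i (x (i + 1)) - P i (x i))"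
    and cont: "\<And>i. continuous_on S (P i)"
    and P: "\<And>i t D. has_delta_deriv S h D t \<Longrightarrow> t \<in> S \<Longrightarrow> t < b \<Longrightarrow>
        has_delta_deriv S (P i) ((t - \<alpha> (i + 1)) * D) t"
    using montgomery_identity[OF diff] by blast
  have interval: "w i - 4 * \<eta> * (b - a) \<le> P i (x (i + 1)) - P i (x i)" if i: "i < k" for i
  proof -
    let ?\<alpha> = "\<alpha> (i + 1)"
    obtain A where A: "\<And>t. t \<in> S \<Longrightarrow> t < b \<Longrightarrow> has_delta_deriv S A \<bar>t - ?\<alpha>\<bar> t"
      "continuous_on S A" "A (x (i + 1)) - A (x i) = w i"
      using interval_antiderivative[OF i] by blast
    define H where "H t = A t - P i t" for t
    have contH: "continuous_on S H" unfolding H_def by (intro continuous_intros A cont)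
    have H: "has_delta_deriv S H (\<bar>t - ?\<alpha>\<bar> - (t - ?\<alpha>) * sign_approx \<eta> (fwd_jump S t)) t"
      if "t \<in> S" "t < b" for t
      using has_delta_deriv_diff[OF A(1)[OF that] P[OF h[OF that(1)] that]] by (simp add: H_def[abs_def])
    have xi: "x i \<in> S" "x (i + 1) \<in> S" "x i < x (i + 1)" "x (i + 1) \<le> b" "?\<alpha> \<in> S"
      using i xS x_less[OF i] x_mono[of "i + 1" k] xk \<alpha>S by auto
    \<comment> \<open>\<open>r\<close> is the last point within \<eta> of \<open>x i\<close>. Up to
      \<open>r\<close> the loss rate \<open>2 * (b - a)\<close> acts over a length of at most
      \<eta>; from \<open>r\<close> on, every jump lands at or beyond \<open>x i + \<eta>\<close>,
      past the initial ramp.\<close>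
    define B where "B = S \<inter> {x i..min (x i + \<eta>) (x (i + 1))}"
    define r where "r = Sup B"
    have "x i \<in> B" using xi \<eta> by (auto simp: B_def)
    moreover have "closed B" 
      unfolding B_def by (intro closed_Int[OF closed_S] closed_atLeastAtMost)
    moreover have bdd: "bdd_above B" by (auto simp: B_def)
    ultimately have "r \<in> B" unfolding r_def by (intro closed_contains_Sup) auto
    then have r: "r \<in> S" "x i \<le> r" "r \<le> x i + \<eta>" "r \<le> x (i + 1)" by (auto simp: B_def)
    have r_max: "x i + \<eta> < t" if "t \<in> S" "r < t" "t \<le> x (i + 1)" for t
    proof (rule ccontr)
      assume "\<not> x i + \<eta> < t"
      then have "t \<in> B" using that r by (auto simp: B_def)
      then have "t \<le> r" unfolding r_def using bdd by (rule cSup_upper)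
      with that show False by simp
    qed
    have "H r - H (x i) \<le> 2 * (b - a) * (r - x i)"
    proof (rule delta_deriv_le_imp_diff_le[OF closed_S xi(1) r(1) r(2) contH])
      fix t assume t: "t \<in> S" "x i \<le> t" "t < r"
      then have "t < b" using r xi by simp
      have "\<bar>t - ?\<alpha>\<bar> \<le> b - a" using t(1) xi(5) by auto
      from abs_minus_mult_sign_approx_le[OF this]
      have "\<bar>t - ?\<alpha>\<bar> - (t - ?\<alpha>) * sign_approx \<eta> (fwd_jump S t) \<le> 2 * (b - a)" .
      with H[OF t(1) \<open>t < b\<close>] show "\<exists>D\<le>2 * (b - a). has_delta_deriv S H D t" by blast
    qed
    also have "\<dots> \<le> 2 * (b - a) * \<eta>" using r ab by (intro mult_left_mono) auto
    finally have 1: "H r - H (x i) \<le> 2 * (b - a) * \<eta>" .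
    have "H (x (i + 1)) - H r \<le> 2 * \<eta> * (x (i + 1) - r)"
    proof (rule delta_deriv_le_imp_diff_le[OF closed_S r(1) xi(2) r(4) contH])
      fix t assume t: "t \<in> S" "r \<le> t" "t < x (i + 1)"
      then have "t < b" using xi by simp
      let ?\<sigma> = "fwd_jump S t"
      have \<sigma>: "?\<sigma> \<in> S" "t \<le> ?\<sigma>" "?\<sigma> \<le> x (i + 1)"
        using fwd_jump_in[OF closed_S t(1)] fwd_jump_ge fwd_jump_le[OF xi(2) t(3)] by auto
      have big: "x i + \<eta> \<le> ?\<sigma>"
      proof (cases "r < ?\<sigma>")
        case True
        then show ?thesis using r_max[OF \<sigma>(1)] \<sigma>(3) by simp
      next
        case False
        then have "?\<sigma> = t" "t = r" using t \<sigma> by auto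
        show ?thesis
        proof (rule ccontr)
          assume "\<not> x i + \<eta> \<le> ?\<sigma>"
          then obtain s where "s \<in> S" "t < s" "s < x i + \<eta>" "s \<le> x (i + 1)"
            using right_dense_point[OF xi(2) t(3) \<open>?\<sigma> = t\<close>, of "x i + \<eta>"] \<open>?\<sigma> = t\<close> by auto
          with r_max[of s] \<open>t = r\<close> show False by simp
        qed
      qed
      \<comment> \<open>Left of \<open>?\<alpha>\<close> the jump cannot pass
        \<open>?\<alpha>\<close>, so the sign is exact; it is also exact once the jump reaches
        \<open>?\<alpha> + \<eta>\<close>. In between, \<open>t\<close> itself is within \<eta> of
        \<open>?\<alpha>\<close>.\<close>
      have "\<bar>t - ?\<alpha>\<bar> - (t - ?\<alpha>) * sign_approx \<eta> ?\<sigma> \<le> 2 * \<eta>"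
      proof (cases "t < ?\<alpha>")
        case True
        then have "?\<sigma> \<le> ?\<alpha>" using xi by (intro fwd_jump_le)
        then show ?thesis using sign_approx_left[OF \<eta> i big] True \<eta> by simp
      next
        case False
        show ?thesis
        proof (cases "?\<alpha> + \<eta> \<le> ?\<sigma>")
          case True
          then show ?thesis using sign_approx_right[OF \<eta> i big True \<sigma>(3)] False \<eta> by simp
        next
          case small: False
          have "\<bar>t - ?\<alpha>\<bar> \<le> \<eta>" using small False \<sigma>(2) by simp
          then show ?thesis by (rule abs_minus_mult_sign_approx_le)
        qed
      qed
      with H[OF t(1) \<open>t < b\<close>] show "\<exists>D\<le>2 * \<eta>. has_delta_deriv S H D t" by blast
    qed
    also have "\<dots> \<le> 2 * \<eta> * (b - a)" using r(1) xi(2) \<eta> by (intro mult_left_mono) auto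
    finally have "H (x (i + 1)) - H (x i) \<le> 4 * \<eta> * (b - a)" using 1 by (simp add: algebra_simps)
    then show ?thesis using A(3) by (simp add: H_def)
  qed
  have "W - \<epsilon> < W - 4 * \<eta> * (b - a) * real k"
    using kba \<open>\<epsilon> > 0\<close> ab k by (simp add: \<eta>_def)
  also have "\<dots> = (\<Sum>i<k. w i - 4 * \<eta> * (b - a))"
    by (simp add: weight_eq sum_subtractf mult.commute)
  also have "\<dots> \<le> (\<Sum>i<k. P i (x (i + 1)) - P i (x i))" using interval by (intro sum_mono) auto
  also have "\<dots> \<le> \<bar>L h\<bar>" by (simp add: L)
  finally have "W - \<epsilon> < \<bar>L h\<bar>" .
  moreover have "\<bar>delta_deriv S h t\<bar> \<le> 1" if "t \<in> S" "t < b" for t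
    using delta_deriv_eq[OF h[OF that(1)] that(1) bS that(2)] abs_sign_approx_le by simp
  ultimately show ?thesis using diff that by blast
qed

section \<open>The supremum and its comparison with the error\<close>

lemma I_subset: "t \<in> I \<Longrightarrow> t \<in> S" "t \<in> I \<Longrightarrow> t < b"
  by (auto split: if_splits)

lemma sup_eq: "ostrowski_sup T a b \<alpha> f = (SUP t\<in>I. ereal \<bar>delta_deriv S f t\<bar>)"
  by (simp add: ostrowski_sup_def)

lemma sup_upper: "t \<in> I \<Longrightarrow> ereal \<bar>delta_deriv S f t\<bar> \<le> ostrowski_sup T a b \<alpha> f"
  unfolding sup_eq by (rule SUP_upper)

text \<open>Were \<open>I\<close> empty, the upper bound would hold with M = 0 for every function,
  contrary to a function of nonzero error. This keeps the supremum from being that of the empty set,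
  minus infinity.\<close>

lemma I_nonempty:
  assumes "W > 0"
  shows "I \<noteq> {}"
proof
  assume "I = {}"
  obtain h where h: "delta_differentiable S h" "W - W < \<bar>L h\<bar>"
    using near_extremal[OF assms] by blast
  have "\<bar>L h\<bar> \<le> 0 * W" using \<open>I = {}\<close> by (intro error_le[OF h(1)]) auto
  with h show False by simp
qed

lemma sup_nonneg:
  assumes "W > 0"
  shows "ostrowski_sup T a b \<alpha> f \<ge> 0"
proof -
  obtain t where "t \<in> I" using I_nonempty[OF assms] by blast
  from sup_upper[OF this, of f] show ?thesis
    by (rule order_trans[rotated]) simp
qed

lemma error_le_sup:
  assumes f: "delta_differentiable S f"
  shows "ereal \<bar>L f\<bar> \<le> ostrowski_sup T a b \<alpha> f * ereal W"
proof (cases "W = 0")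
  case True
  \<comment> \<open>A product with 0 is 0 in \<open>ereal\<close> even for an infinite factor, so
    the error itself has to vanish.\<close>
  then show ?thesis using error_eq_0[OF f] by (simp flip: zero_ereal_def)
next
  case False
  then have "W > 0" using weight_nonneg by simp
  show ?thesis
  proof (cases "ostrowski_sup T a b \<alpha> f")
    case (real M)
    then have "\<bar>L f\<bar> \<le> M * W" using sup_upper[of _ f] by (intro error_le[OF f]) simp
    then show ?thesis using real by simp
  next
    case PInf
    then show ?thesis using \<open>W > 0\<close> by simp
  next
    case MInf
    then show ?thesis using sup_nonneg[OF \<open>W > 0\<close>, of f] by simp
  qed
qed

lemma sup_cmult:
  assumes h: "delta_differentiable S h" and "c > 0" and s: "ostrowski_sup T a b \<alpha> h = ereal s"
    and "I \<noteq> {}"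
  shows "ostrowski_sup T a b \<alpha> (\<lambda>t. c * h t) = ereal (c * s)"
proof -
  have D: "delta_deriv S (\<lambda>t. c * h t) t = c * delta_deriv S h t" if "t \<in> I" for t
    using I_subset[OF that] bS
    by (intro delta_deriv_eq[where d = b] has_delta_deriv_cmult diff_S[OF h]) auto
  have "ostrowski_sup T a b \<alpha> (\<lambda>t. c * h t) = (SUP t\<in>I. ereal c * ereal \<bar>delta_deriv S h t\<bar>)"
    unfolding sup_eq using D \<open>c > 0\<close> by (intro SUP_cong) (auto simp: abs_mult)
  also have "\<dots> = ereal c * (SUP t\<in>I. ereal \<bar>delta_deriv S h t\<bar>)"
    
    using \<open>I \<noteq> {}\<close> \<open>c > 0\<close> by (intro Sup_ereal_mult_left'[symmetric]) auto
  finally show ?thesis using s unfolding sup_eq by simp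
qed

lemma sharp:
  assumes f: "delta_differentiable S f" and R: "ereal R < ostrowski_sup T a b \<alpha> f * ereal W"
  shows "\<exists>g. delta_differentiable S g \<and> ostrowski_sup T a b \<alpha> g = ostrowski_sup T a b \<alpha> f \<and> R < \<bar>L g\<bar>"
proof (cases "R < 0")
  case True
  then show ?thesis using f by (intro exI[of _ f]) auto
next
  case False
  have "W \<noteq> 0" using R False by (auto simp flip: zero_ereal_def)
  then have "W > 0" using weight_nonneg by simp
  note ne = I_nonempty[OF this]
  show ?thesis
  proof (cases "ostrowski_sup T a b \<alpha> f")
    case (real M)
    with R have RM: "R < M * W" by simp
    then have "M > 0" using False \<open>W > 0\<close> by (smt (verit) mult_nonpos_nonneg)
    have "R / M < W" using RM \<open>M > 0\<close> by (simp add: pos_divide_less_eq mult.commute)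
    then obtain h where h: "delta_differentiable S h" "\<And>t. t \<in> S \<Longrightarrow> t < b \<Longrightarrow> \<bar>delta_deriv S h t\<bar> \<le> 1"
      "W - (W - R / M) < \<bar>L h\<bar>"
      using near_extremal[of "W - R / M"] by (metis diff_gt_0_iff_gt)
    have "ostrowski_sup T a b \<alpha> h \<le> ereal 1"
      unfolding sup_eq
    proof (rule SUP_least)
      fix t assume "t \<in> I"
      from h(2)[OF I_subset[OF this]] show "ereal \<bar>delta_deriv S h t\<bar> \<le> ereal 1" by simp
    qed
    \<comment> \<open>The supremum of \<open>h\<close> over \<open>I\<close> may fall short of 1.
      The upper bound applied to \<open>h\<close> shows that it is positive, and dividing by s \<le>
      1 only enlarges the error.\<close>
    then obtain s where s: "ostrowski_sup T a b \<alpha> h = ereal s" "0 \<le> s" "s \<le> 1"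
      using sup_nonneg[OF \<open>W > 0\<close>, of h] by (cases "ostrowski_sup T a b \<alpha> h") auto
    have "R / M \<ge> 0" using False \<open>M > 0\<close> by simp
    then have "\<bar>L h\<bar> > 0" using h(3) by linarith
    moreover have "\<bar>L h\<bar> \<le> s * W" using error_le_sup[OF h(1)] s by simp
    ultimately have "s > 0" using s by (cases "s = 0") auto
    define c where "c = M / s"
    have "c > 0" "c * s = M" using \<open>M > 0\<close> \<open>s > 0\<close> by (auto simp: c_def)
    have zero: "delta_differentiable S (\<lambda>_. 0)"
      using has_delta_deriv_const by (auto simp: delta_differentiable_def)
    have "L (\<lambda>t. 0 + c * h t) = L (\<lambda>_. 0) + c * L h" by (rule L_add_cmult[OF zero h(1)])
    moreover have "L (\<lambda>_. 0) = 0"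
      using L_add_cmult[OF zero zero, of 1] by simp
    ultimately have Lc: "L (\<lambda>t. c * h t) = c * L h" by simp
    have "R < M * \<bar>L h\<bar>" using h(3) \<open>M > 0\<close> by (simp add: pos_divide_less_eq mult.commute)
    also have "\<dots> \<le> c * \<bar>L h\<bar>"
      using s \<open>s > 0\<close> \<open>M > 0\<close> by (intro mult_right_mono) (auto simp: c_def pos_le_divide_eq)
    also have "\<dots> = \<bar>L (\<lambda>t. c * h t)\<bar>" using Lc \<open>c > 0\<close> by (simp add: abs_mult)
    finally have "R < \<bar>L (\<lambda>t. c * h t)\<bar>" .
    moreover have "delta_differentiable S (\<lambda>t. c * h t)"
      using delta_differentiable_add_cmult[OF zero h(1), of c] by simp
    ultimately show ?thesis
      using sup_cmult[OF h(1) \<open>c > 0\<close> s(1) ne] \<open>c * s = M\<close> real by metis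
  next
    case PInf
    obtain h where h: "delta_differentiable S h" "\<And>t. t \<in> S \<Longrightarrow> t < b \<Longrightarrow> \<bar>delta_deriv S h t\<bar> \<le> 1"
      "W - W < \<bar>L h\<bar>"
      using near_extremal[OF \<open>W > 0\<close>] by blast
    \<comment> \<open>Chosen so that \<open>L g\<close> is exactly R + 1. The added derivative is at
      most |c| in modulus, so the supremum remains infinite.\<close>
    define c where "c = (R + 1 - L f) / L h"
    define g where "g t = f t + c * h t" for t
    have g: "delta_differentiable S g"
      unfolding g_def by (rule delta_differentiable_add_cmult[OF f h(1)])
    have "L g = R + 1"
      using L_add_cmult[OF f h(1), of c] h(3) by (simp add: g_def[abs_def] c_def)
    then have "R < \<bar>L g\<bar>" by simp
    moreover have "ostrowski_sup T a b \<alpha> g = \<infinity>"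
    proof (rule ereal_top)
      fix B :: real
      have "ereal (B + \<bar>c\<bar>) < (SUP t\<in>I. ereal \<bar>delta_deriv S f t\<bar>)" using PInf sup_eq by simp
      then obtain t where t: "t \<in> I" "B + \<bar>c\<bar> < \<bar>delta_deriv S f t\<bar>"
        unfolding less_SUP_iff by auto
      note tS = I_subset[OF t(1)]
      have "\<bar>c * delta_deriv S h t\<bar> \<le> \<bar>c\<bar> * 1"
        unfolding abs_mult using h(2)[OF tS] by (intro mult_left_mono) auto
      moreover have "delta_deriv S g t = delta_deriv S f t + c * delta_deriv S h t"
        unfolding g_def by (rule delta_deriv_add_cmult[OF f h(1) tS])
      ultimately have "B \<le> \<bar>delta_deriv S g t\<bar>" using t(2) by linarith
      then have "ereal B \<le> ereal \<bar>delta_deriv S g t\<bar>" by simp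
      also have "\<dots> \<le> ostrowski_sup T a b \<alpha> g" by (rule sup_upper[OF t(1)])
      finally show "ereal B \<le> ostrowski_sup T a b \<alpha> g" .
    qed
    ultimately show ?thesis using g PInf by auto
  next
    case MInf
    then show ?thesis using sup_nonneg[OF \<open>W > 0\<close>, of f] by simp
  qed
qed

end

text \<open>Sharpness is approached rather than attained: the ideal derivative, the sign of t -
  \<alpha>_{i+1}, jumps and need not be a delta derivative, as for the real line and an
  \<alpha>_{i+1} inside its interval.\<close>

theorem theorem3:
  fixes T :: "real set" and a b :: real and k :: nat
    and x \<alpha> :: "nat \<Rightarrow> real" and f :: "real \<Rightarrow> real"
  assumes "time_scale T"
    and "a \<in> T" and "b \<in> T"
    and "k \<ge> 1"
    and "\<forall>i\<le>k. x i \<in> T" and "x 0 = a" and "x k = b" and "\<forall>i<k. x i < x (i + 1)"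
    and "\<forall>i\<le>k + 1. \<alpha> i \<in> T" and "\<alpha> 0 = a" and "\<alpha> (k + 1) = b"
    and "\<forall>i\<in>{1..k}. \<alpha> i \<in> {x (i - 1)..x i}"
    and "delta_differentiable ({a..b} \<inter> T) f"
  shows "ereal (ostrowski_error T a b k x \<alpha> f)
           \<le> ostrowski_sup T a b \<alpha> f * ereal (ostrowski_weight T k x \<alpha>)
       \<and> (\<forall>R::real. ereal R < ostrowski_sup T a b \<alpha> f * ereal (ostrowski_weight T k x \<alpha>) \<longrightarrow>
            (\<exists>g. delta_differentiable ({a..b} \<inter> T) g
               \<and> ostrowski_sup T a b \<alpha> g = ostrowski_sup T a b \<alpha> f
               \<and> R < ostrowski_error T a b k x \<alpha> g))"
proof -
  interpret subdivision T a b k x \<alpha>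
  proof
    show "x i \<le> \<alpha> (i + 1) \<and> \<alpha> (i + 1) \<le> x (i + 1)" if "i < k" for i
      using bspec[OF assms(12), of "i + 1"] that by simp
  qed (use assms in \<open>auto simp: time_scale_def\<close>)
  show ?thesis
    unfolding error_eq using error_le_sup sharp assms(13) by blast
qed

end
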